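(* Fix $\eta\in[0,1]$ and an integer $N\ge0$, and let $\bar C_{\mathrm{BEHC}}(N)$ be the capacity of the boosted BEHC$(N)$. Then $$\bar C_{\mathrm{BEHC}}(N)\ \le\ \sup I(U^{+},U;X\mid Q),$$ where the supremum is over (finite) auxiliary alphabets $\mathcal U$, functions $f:\mathcal U\times\{0,1\}\to\{0,1\}$ with $f(u^{+},0)=0$ for all $u^{+}$, and policies $P(u^{+}\mid u,q)$ ($u,u^{+}\in\mathcal U$, $q\in\mathcal Q$) for which the kernel $T(s^{+},u^{+},q^{+}\mid s,u,q)=\sum_xP(u^{+}\mid u,q)\mathbb{1}\{x=f(u^{+},s)\}\mathbb{1}\{q^{+}=g_U(q,x)\}P_U(s^{+}\mid x,s,q)$ has a unique stationary distribution $\pi(s,u,q)$, and the mutual information is computed under the joint PMF $$\pi(s,u,q)P(u^{+}\mid u,q)\mathbb{1}\{x=f(u^{+},s)\}P_U(s^{+}\mid x,s,q)\mathbb{1}\{q^{+}=g_U(q,x)\}.$$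
   Context: $\bar\eta=1-\eta$, $[a:b]=\{a,\dots,b\}$. $\mathcal Q=[0:N]$, $g_U:\mathcal Q\times\{0,1\}\to\mathcal Q$: $g_U(q,1)=0$, $g_U(q,0)=q+1$ for $q\in[0:N-1]$, $g_U(N,0)=N$. BEHC battery law: $P(S^{+}=0\mid x,s)=\bar\eta\,\mathbb{1}\{x=s\}$ for $x\le s$. Modified law: $P_U(s^{+}\mid x,s,q)=\mathbb{1}\{s^{+}=1\}$ if $q\in\{N-1,N\}$ and $x=0$, and equal to the BEHC law otherwise. Boosted BEHC$(N)$: binary inputs with $X_i\le S_{i-1}$, $S_0=0$, $Q_0=0$, $Q_i=g_U(Q_{i-1},X_i)$, $S_i\sim P_U(\cdot\mid X_i,S_{i-1},Q_{i-1})$ given the past, output $Y_i=X_i$ (a BEHC with i.i.d. Bernoulli$(\eta)$ energy arrivals in which transmitting $N$ consecutive zeros charges the battery). Codes: message $M$ uniform on $\{1,\dots,2^{nR}\}$, encoder $X_i=e_i(M,S^{i-1},Y^{i-1})$ with $X_i\le S_{i-1}$, decoder $\hat M=d(Y^n)$; $R$ achievable if average error probability $\to0$; capacity is the supremum of achievable rates. *)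

theory Defs
  imports "HOL-Analysis.Analysis"
begin

text \<open>Binary symbols (inputs, battery states) are naturals in {0,1};
  the counter alphabet is Q = {0..N}.\<close>

definition gU :: "nat \<Rightarrow> nat \<Rightarrow> nat \<Rightarrow> nat" where
  "gU N q x = (if x = 1 then 0 else min (q + 1) N)"

text \<open>BEHC battery law P(s'|x,s) (meaningful for x \<le> s):
  P(S'=0|x,s) = (1-eta) [x = s], P(S'=1|x,s) = 1 - P(S'=0|x,s).\<close>
definition behc_law :: "real \<Rightarrow> nat \<Rightarrow> nat \<Rightarrow> nat \<Rightarrow> real" where
  "behc_law \<eta> x s s' =
     (let p0 = (if x = s then 1 - \<eta> else 0)
      in if s' = 0 then p0 else if s' = 1 then 1 - p0 else 0)"

text \<open>Modified law P_U(s'|x,s,q).  Note N - 1 is truncated subtraction;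
  for N = 0 the set {N-1,N} meets Q = {0} in {0}, as in the paper.\<close>
definition PU :: "real \<Rightarrow> nat \<Rightarrow> nat \<Rightarrow> nat \<Rightarrow> nat \<Rightarrow> nat \<Rightarrow> real" where
  "PU \<eta> N x s q s' =
     (if (q = N - 1 \<or> q = N) \<and> x = 0 then (if s' = 1 then 1 else 0)
      else behc_law \<eta> x s s')"

text \<open>An encoder e i m shist yhist gives X_i from the message m,
  S^{i-1} = [s_1,...,s_{i-1}] and Y^{i-1} = [y_1,...,y_{i-1}].
  Given a realisation sl = [s_1,...,s_n] of the battery states,
  enc_x e m sl i is the list [x_1,...,x_i] (outputs Y_j = X_j).\<close>
fun enc_x :: "(nat \<Rightarrow> nat \<Rightarrow> nat list \<Rightarrow> nat list \<Rightarrow> nat) \<Rightarrow> nat \<Rightarrow> nat list \<Rightarrow> nat \<Rightarrow> nat list" where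
  "enc_x e m sl 0 = []"
| "enc_x e m sl (Suc i) = (let xs = enc_x e m sl i in xs @ [e (Suc i) m (take i sl) xs])"

definition q_after :: "nat \<Rightarrow> nat list \<Rightarrow> nat" where
  "q_after N xs = foldl (gU N) 0 xs"

definition state_seqs :: "nat \<Rightarrow> nat list set" where
  "state_seqs n = {sl. length sl = n \<and> set sl \<subseteq> {0, 1}}"

definition state_prob :: "real \<Rightarrow> nat \<Rightarrow> (nat \<Rightarrow> nat \<Rightarrow> nat list \<Rightarrow> nat list \<Rightarrow> nat)
    \<Rightarrow> nat \<Rightarrow> nat \<Rightarrow> nat list \<Rightarrow> real" where
  "state_prob \<eta> N e n m sl =
     (let xs = enc_x e m sl n
      in \<Prod>i\<in>{1..n}. PU \<eta> N (xs ! (i - 1)) ((0 # sl) ! (i - 1))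
                         (q_after N (take (i - 1) xs)) (sl ! (i - 1)))"

definition valid_code :: "nat \<Rightarrow> (nat \<Rightarrow> nat \<Rightarrow> nat list \<Rightarrow> nat list \<Rightarrow> nat) \<Rightarrow> nat \<Rightarrow> nat \<Rightarrow> bool" where
  "valid_code N e n M \<longleftrightarrow>
     (\<forall>m\<in>{1..M}. \<forall>sl\<in>state_seqs n. \<forall>i\<in>{1..n}.
        enc_x e m sl n ! (i - 1) \<le> (0 # sl) ! (i - 1))"

definition err_prob :: "real \<Rightarrow> nat \<Rightarrow> (nat \<Rightarrow> nat \<Rightarrow> nat list \<Rightarrow> nat list \<Rightarrow> nat)
    \<Rightarrow> (nat list \<Rightarrow> nat) \<Rightarrow> nat \<Rightarrow> nat \<Rightarrow> real" where
  "err_prob \<eta> N e d n M =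
     (1 / real M) * (\<Sum>m\<in>{1..M}. \<Sum>sl\<in>state_seqs n.
        state_prob \<eta> N e n m sl * (if d (enc_x e m sl n) \<noteq> m then 1 else 0))"

definition num_msgs :: "real \<Rightarrow> nat \<Rightarrow> nat" where
  "num_msgs R n = nat \<lceil>2 powr (real n * R)\<rceil>"

definition achievable :: "real \<Rightarrow> nat \<Rightarrow> real \<Rightarrow> bool" where
  "achievable \<eta> N R \<longleftrightarrow>
     (\<exists>E :: nat \<Rightarrow> (nat \<Rightarrow> nat \<Rightarrow> nat list \<Rightarrow> nat list \<Rightarrow> nat).
      \<exists>D :: nat \<Rightarrow> (nat list \<Rightarrow> nat).
        (\<forall>n. valid_code N (E n) n (num_msgs R n)) \<and>
        (\<lambda>n. err_prob \<eta> N (E n) (D n) n (num_msgs R n)) \<longlonglongrightarrow> 0)"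

definition boosted_capacity :: "real \<Rightarrow> nat \<Rightarrow> ereal" where
  "boosted_capacity \<eta> N = Sup {ereal R | R. achievable \<eta> N R}"

definition cond_mi :: "'a set \<Rightarrow> 'b set \<Rightarrow> 'c set \<Rightarrow> ('a \<Rightarrow> 'b \<Rightarrow> 'c \<Rightarrow> real) \<Rightarrow> real" where
  "cond_mi A B C p =
     (\<Sum>a\<in>A. \<Sum>b\<in>B. \<Sum>c\<in>C.
        if p a b c = 0 then 0
        else p a b c * log 2 (p a b c * (\<Sum>a'\<in>A. \<Sum>b'\<in>B. p a' b' c)
                              / ((\<Sum>b'\<in>B. p a b' c) * (\<Sum>a'\<in>A. p a' b c))))"

text \<open>Auxiliary alphabet U = {0..<k}; state space {0,1} x U x Q.\<close>
definition Omega :: "nat \<Rightarrow> nat \<Rightarrow> (nat \<times> nat \<times> nat) set" where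
  "Omega k N = {0, 1} \<times> {0..<k} \<times> {0..N}"

definition valid_f :: "nat \<Rightarrow> (nat \<Rightarrow> nat \<Rightarrow> nat) \<Rightarrow> bool" where
  "valid_f k f \<longleftrightarrow> (\<forall>u\<in>{0..<k}. \<forall>s\<in>{0, 1}. f u s \<in> {0, 1}) \<and> (\<forall>u\<in>{0..<k}. f u 0 = 0)"

text \<open>P u' u q = P(u^+ = u' | u, q).\<close>
definition valid_policy :: "nat \<Rightarrow> nat \<Rightarrow> (nat \<Rightarrow> nat \<Rightarrow> nat \<Rightarrow> real) \<Rightarrow> bool" where
  "valid_policy k N P \<longleftrightarrow>
     (\<forall>u\<in>{0..<k}. \<forall>q\<in>{0..N}.
        (\<forall>u'\<in>{0..<k}. P u' u q \<ge> 0) \<and> (\<Sum>u'\<in>{0..<k}. P u' u q) = 1)"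

definition kernelT :: "real \<Rightarrow> nat \<Rightarrow> (nat \<Rightarrow> nat \<Rightarrow> nat) \<Rightarrow> (nat \<Rightarrow> nat \<Rightarrow> nat \<Rightarrow> real)
    \<Rightarrow> nat \<times> nat \<times> nat \<Rightarrow> nat \<times> nat \<times> nat \<Rightarrow> real" where
  "kernelT \<eta> N f P w' w =
     (case w of (s, u, q) \<Rightarrow> case w' of (s', u', q') \<Rightarrow>
        \<Sum>x\<in>{0, 1}. P u' u q * (if x = f u' s then 1 else 0)
                    * (if q' = gU N q x then 1 else 0) * PU \<eta> N x s q s')"

definition stationary :: "real \<Rightarrow> nat \<Rightarrow> nat \<Rightarrow> (nat \<Rightarrow> nat \<Rightarrow> nat) \<Rightarrow> (nat \<Rightarrow> nat \<Rightarrow> nat \<Rightarrow> real)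
    \<Rightarrow> (nat \<times> nat \<times> nat \<Rightarrow> real) \<Rightarrow> bool" where
  "stationary \<eta> N k f P \<pi> \<longleftrightarrow>
     (\<forall>w\<in>Omega k N. \<pi> w \<ge> 0) \<and> (\<forall>w. w \<notin> Omega k N \<longrightarrow> \<pi> w = 0) \<and>
     (\<Sum>w\<in>Omega k N. \<pi> w) = 1 \<and>
     (\<forall>w'\<in>Omega k N. \<pi> w' = (\<Sum>w\<in>Omega k N. \<pi> w * kernelT \<eta> N f P w' w))"

definition joint_uux_q :: "real \<Rightarrow> nat \<Rightarrow> (nat \<Rightarrow> nat \<Rightarrow> nat) \<Rightarrow> (nat \<Rightarrow> nat \<Rightarrow> nat \<Rightarrow> real)
    \<Rightarrow> (nat \<times> nat \<times> nat \<Rightarrow> real) \<Rightarrow> nat \<times> nat \<Rightarrow> nat \<Rightarrow> nat \<Rightarrow> real" where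
  "joint_uux_q \<eta> N f P \<pi> uu x q =
     (case uu of (u', u) \<Rightarrow>
       \<Sum>s\<in>{0, 1}. \<Sum>s'\<in>{0, 1}. \<Sum>q'\<in>{0..N}.
         \<pi> (s, u, q) * P u' u q * (if x = f u' s then 1 else 0)
         * PU \<eta> N x s q s' * (if q' = gU N q x then 1 else 0))"

definition upper_bound :: "real \<Rightarrow> nat \<Rightarrow> ereal" where
  "upper_bound \<eta> N = Sup {ereal (cond_mi ({0..<k} \<times> {0..<k}) {0, 1} {0..N}
                               (joint_uux_q \<eta> N f P (THE \<pi>. stationary \<eta> N k f P \<pi>)))
                          | k f P. k \<ge> 1 \<and> valid_f k f \<and> valid_policy k N P \<and>
                                   (\<exists>!\<pi>. stationary \<eta> N k f P \<pi>)}"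

end

theory Submission
  imports Defs
begin

text \<open>
  Let \<open>N > 0\<close> (for \<open>N = 0\<close> the bound is at least 1: alternate the strategies \<open>x = 0\<close> and \<open>x = s\<close>).
  Given a code of length \<open>n\<close>, let the auxiliary symbol run through blocks of length \<open>n + N + 1\<close>:
  \<open>N\<close> zeros charge the battery surely, a one then resets the counter and leaves a battery that is
  Bernoulli(\<open>\<eta>\<close>) and independent of the past, and then a uniform message is sent with the code. This
  renewal makes the stationary law unique. As \<open>q = 0\<close> exactly after an input 1, the auxiliary symbol
  can record all inputs of the block, and given message and past inputs a random strategy bit, drawn
  without knowledge of the battery, reproduces the input law of the code: the weight of a full
  battery dominates the one under the code, because both obey the same monotone recursion and the
  code starts with an empty battery.

  For the test conditional law of \<open>X\<close> given message and past inputs, Gibbs' inequality bounds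
  \<open>(n + N + 1) I(U\<^sup>+, U; X | Q)\<close> from below by the divergence of the code's input law from the path
  measure \<open>\<Prod> \<pi>(x\<^sub>i | q\<^sub>i\<^sub>-\<^sub>1)\<close>, which is at least \<open>(1 - \<epsilon>) log M - 1\<close> by a change of measure.
\<close>

section \<open>Information inequalities\<close>

lemma mult_log_divide_ge:
  fixes b p t :: real
  assumes "1 < b" "0 \<le> p" "0 \<le> t" "0 < p \<Longrightarrow> 0 < t"
  shows "(p - t) / ln b \<le> p * log b (p / t)"
proof (cases "p = 0")
  case True
  thus ?thesis using assms by simp
next
  case False
  hence pos: "0 < p" "0 < t" using assms by auto
  have "ln (t / p) \<le> t / p - 1"
    using pos by (intro ln_le_minus_one) simp
  hence "p * ln (t / p) \<le> p * (t / p - 1)"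
    using pos by (intro mult_left_mono) auto
  hence "p - t \<le> p * ln (p / t)"
    using pos by (simp add: ln_div algebra_simps)
  hence "(p - t) / ln b \<le> p * ln (p / t) / ln b"
    using assms(1) by (intro divide_right_mono) auto
  thus ?thesis by (simp add: log_def)
qed

lemma gibbs_inequality:
  fixes p t g :: "'i \<Rightarrow> real"
  assumes b: "1 < b"
    and p_nonneg: "\<And>i. i \<in> I \<Longrightarrow> 0 \<le> p i" and t_nonneg: "\<And>i. i \<in> I \<Longrightarrow> 0 \<le> t i"
    and t_pos: "\<And>i. i \<in> I \<Longrightarrow> 0 < p i \<Longrightarrow> 0 < t i"
    and g_pos: "\<And>i. i \<in> I \<Longrightarrow> 0 < p i \<Longrightarrow> 0 < g i"
    and sum_le: "sum t I \<le> sum p I"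
  shows "(\<Sum>i\<in>I. p i * log b (t i / g i)) \<le> (\<Sum>i\<in>I. p i * log b (p i / g i))"
proof -
  have log_ratio: "p i * log b (p i / t i) = p i * log b (p i / g i) - p i * log b (t i / g i)"
    if "i \<in> I" for i
  proof (cases "p i = 0")
    case False
    hence "0 < p i" using p_nonneg[OF that] by simp
    thus ?thesis using t_pos[OF that] g_pos[OF that] by (simp add: log_divide algebra_simps)
  qed simp
  have "0 \<le> (sum p I - sum t I) / ln b" using sum_le b by simp
  also have "\<dots> = (\<Sum>i\<in>I. (p i - t i) / ln b)"
    by (simp add: sum_subtractf flip: sum_divide_distrib)
  also have "\<dots> \<le> (\<Sum>i\<in>I. p i * log b (p i / t i))"
    by (intro sum_mono mult_log_divide_ge b p_nonneg t_nonneg t_pos)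
  also have "\<dots> = (\<Sum>i\<in>I. p i * log b (p i / g i)) - (\<Sum>i\<in>I. p i * log b (t i / g i))"
    by (simp add: log_ratio sum_subtractf)
  finally show ?thesis by simp
qed

definition cond_marginal :: "'a set \<Rightarrow> 'b set \<Rightarrow> ('a \<Rightarrow> 'b \<Rightarrow> 'c \<Rightarrow> real) \<Rightarrow> 'b \<Rightarrow> 'c \<Rightarrow> real" where
  "cond_marginal A B p b c = (\<Sum>a\<in>A. p a b c) / (\<Sum>a\<in>A. \<Sum>b'\<in>B. p a b' c)"

lemma cond_marginal_nonneg:
  assumes "\<And>a b. a \<in> A \<Longrightarrow> b \<in> B \<Longrightarrow> 0 \<le> p a b c" "b \<in> B"
  shows "0 \<le> cond_marginal A B p b c"
  unfolding cond_marginal_def using assms by (intro divide_nonneg_nonneg sum_nonneg) auto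

lemma sum_cond_marginal_le_1: "(\<Sum>b\<in>B. cond_marginal A B p b c) \<le> 1"
  unfolding cond_marginal_def sum_divide_distrib[symmetric]
  by (subst sum.swap) simp

lemma cond_marginal_pos:
  assumes "\<And>a b. a \<in> A \<Longrightarrow> b \<in> B \<Longrightarrow> 0 \<le> p a b c"
    and "finite B" "b \<in> B" "0 < (\<Sum>a\<in>A. p a b c)"
  shows "0 < cond_marginal A B p b c"
proof -
  have "(\<Sum>a\<in>A. p a b c) \<le> (\<Sum>a\<in>A. \<Sum>b'\<in>B. p a b' c)"
    using assms by (intro sum_mono member_le_sum) auto
  thus ?thesis using assms(4) by (simp add: cond_marginal_def)
qed

lemma cond_mi_reindex:
  assumes bij: "bij_betw h A A'"
    and eq: "\<And>a b c. a \<in> A \<Longrightarrow> b \<in> B \<Longrightarrow> c \<in> C \<Longrightarrow> p a b c = p' (h a) b c"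
  shows "cond_mi A B C p = cond_mi A' B C p'"
  unfolding cond_mi_def sum.reindex_bij_betw[OF bij, symmetric]
  by (intro sum.cong refl) (simp add: eq)

lemma sum_marginal_mult_le:
  fixes p \<rho> :: "'a \<Rightarrow> 'b \<Rightarrow> 'c \<Rightarrow> real"
  assumes p_nonneg: "\<And>a b c. a \<in> A \<Longrightarrow> b \<in> B \<Longrightarrow> c \<in> C \<Longrightarrow> 0 \<le> p a b c"
    and \<rho>_sum: "\<And>a c. a \<in> A \<Longrightarrow> c \<in> C \<Longrightarrow> (\<Sum>b\<in>B. \<rho> a b c) \<le> 1"
  shows "(\<Sum>(a, b, c)\<in>A \<times> B \<times> C. (\<Sum>b'\<in>B. p a b' c) * \<rho> a b c) \<le> (\<Sum>(a, b, c)\<in>A \<times> B \<times> C. p a b c)"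
proof -
  have "(\<Sum>(a, b, c)\<in>A \<times> B \<times> C. (\<Sum>b'\<in>B. p a b' c) * \<rho> a b c)
      = (\<Sum>a\<in>A. \<Sum>c\<in>C. (\<Sum>b'\<in>B. p a b' c) * (\<Sum>b\<in>B. \<rho> a b c))"
    by (simp add: sum.swap[of _ B C] sum_distrib_left flip: sum.cartesian_product)
  also have "\<dots> \<le> (\<Sum>a\<in>A. \<Sum>c\<in>C. \<Sum>b'\<in>B. p a b' c)"
    using \<rho>_sum p_nonneg by (intro sum_mono mult_left_le sum_nonneg) auto
  also have "\<dots> = (\<Sum>(a, b, c)\<in>A \<times> B \<times> C. p a b c)"
    by (simp add: sum.swap[of _ B C] flip: sum.cartesian_product)
  finally show ?thesis .
qed

lemma cond_mi_ge_test_law: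
  fixes p \<rho> :: "'a \<Rightarrow> 'b \<Rightarrow> 'c \<Rightarrow> real"
  assumes fin: "finite A" "finite B"
    and p_nonneg: "\<And>a b c. a \<in> A \<Longrightarrow> b \<in> B \<Longrightarrow> c \<in> C \<Longrightarrow> 0 \<le> p a b c"
    and \<rho>_nonneg: "\<And>a b c. a \<in> A \<Longrightarrow> b \<in> B \<Longrightarrow> c \<in> C \<Longrightarrow> 0 \<le> \<rho> a b c"
    and \<rho>_sum: "\<And>a c. a \<in> A \<Longrightarrow> c \<in> C \<Longrightarrow> (\<Sum>b\<in>B. \<rho> a b c) \<le> 1"
    and \<rho>_pos: "\<And>a b c. a \<in> A \<Longrightarrow> b \<in> B \<Longrightarrow> c \<in> C \<Longrightarrow> 0 < p a b c \<Longrightarrow> 0 < \<rho> a b c"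
  shows "(\<Sum>a\<in>A. \<Sum>b\<in>B. \<Sum>c\<in>C. p a b c * log 2 (\<rho> a b c / cond_marginal A B p b c))
    \<le> cond_mi A B C p"
proof -
  define pAC where "pAC a c = (\<Sum>b\<in>B. p a b c)" for a c
  define t where "t = (\<lambda>(a, b, c). pAC a c * \<rho> a b c)"
  define g where "g = (\<lambda>(a, b, c). pAC a c * cond_marginal A B p b c)"
  have pAC_nonneg: "0 \<le> pAC a c" if "a \<in> A" "c \<in> C" for a c
    unfolding pAC_def using that by (intro sum_nonneg p_nonneg)
  have pAC_pos: "0 < pAC a c" if "a \<in> A" "b \<in> B" "c \<in> C" "0 < p a b c" for a b c
    unfolding pAC_def using that by (intro sum_pos2[of B b] fin p_nonneg)
  have marginal_pos: "0 < cond_marginal A B p b c"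
    if "a \<in> A" "b \<in> B" "c \<in> C" "0 < p a b c" for a b c
    using that by (intro cond_marginal_pos sum_pos2[of A a] fin p_nonneg)
  have test_term: "p a b c * log 2 (t (a, b, c) / g (a, b, c))
      = p a b c * log 2 (\<rho> a b c / cond_marginal A B p b c)"
    if "a \<in> A" "b \<in> B" "c \<in> C" for a b c
    using pAC_pos[OF that] p_nonneg[OF that] by (cases "p a b c = 0") (auto simp: t_def g_def)
  have mass: "sum t (A \<times> B \<times> C) \<le> (\<Sum>(a, b, c)\<in>A \<times> B \<times> C. p a b c)"
    unfolding t_def pAC_def using p_nonneg \<rho>_sum by (rule sum_marginal_mult_le)
  have "(\<Sum>(a, b, c)\<in>A \<times> B \<times> C. p a b c * log 2 (t (a, b, c) / g (a, b, c)))
      \<le> (\<Sum>(a, b, c)\<in>A \<times> B \<times> C. p a b c * log 2 (p a b c / g (a, b, c)))"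
    using gibbs_inequality[of 2 "A \<times> B \<times> C" "\<lambda>(a, b, c). p a b c" t g] mass
    by (fastforce simp: case_prod_unfold t_def g_def p_nonneg \<rho>_nonneg pAC_nonneg
          pAC_pos marginal_pos \<rho>_pos)
  hence "(\<Sum>a\<in>A. \<Sum>b\<in>B. \<Sum>c\<in>C. p a b c * log 2 (t (a, b, c) / g (a, b, c)))
      \<le> (\<Sum>a\<in>A. \<Sum>b\<in>B. \<Sum>c\<in>C. p a b c * log 2 (p a b c / g (a, b, c)))"
    by (simp flip: sum.cartesian_product)
  also have "\<dots> = cond_mi A B C p"
    unfolding cond_mi_def g_def cond_marginal_def pAC_def by (intro sum.cong refl) simp
  finally show ?thesis by (simp add: test_term)
qed

lemma sum_mult_log_le_divergence:
  fixes W w :: "'m \<Rightarrow> 'x \<Rightarrow> real" and G :: "'x \<Rightarrow> real"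
  assumes W_nonneg: "\<And>m x. m \<in> I \<Longrightarrow> x \<in> X \<Longrightarrow> 0 \<le> W m x"
    and G_nonneg: "\<And>x. x \<in> X \<Longrightarrow> 0 \<le> G x" and G_sum: "(\<Sum>x\<in>X. G x) \<le> 1"
    and G_pos: "\<And>m x. m \<in> I \<Longrightarrow> x \<in> X \<Longrightarrow> 0 < W m x \<Longrightarrow> 0 < G x"
    and w_pos: "\<And>m x. 0 < w m x"
    and w_sum: "\<And>x. (\<Sum>m\<in>I. w m x) \<le> (\<Sum>m\<in>I. \<Sum>x\<in>X. W m x)"
  shows "(\<Sum>m\<in>I. \<Sum>x\<in>X. W m x * log 2 (w m x)) \<le> (\<Sum>m\<in>I. \<Sum>x\<in>X. W m x * log 2 (W m x / G x))"
proof -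
  define total where "total = (\<Sum>m\<in>I. \<Sum>x\<in>X. W m x)"
  have total_nonneg: "0 \<le> total" unfolding total_def by (intro sum_nonneg W_nonneg)
  have test_term: "W m x * log 2 (G x * w m x / G x) = W m x * log 2 (w m x)"
    if "m \<in> I" "x \<in> X" for m x
    using G_pos[OF that] W_nonneg[OF that] by (cases "W m x = 0") auto
  have "(\<Sum>(m, x)\<in>I \<times> X. G x * w m x) = (\<Sum>x\<in>X. G x * (\<Sum>m\<in>I. w m x))"
    by (simp add: sum.swap[of _ I X] sum_distrib_left flip: sum.cartesian_product)
  also have "\<dots> \<le> (\<Sum>x\<in>X. G x * total)"
    unfolding total_def by (intro sum_mono mult_left_mono w_sum G_nonneg)
  also have "\<dots> \<le> total"
    using mult_right_mono[OF G_sum total_nonneg] by (simp flip: sum_distrib_right)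
  finally have mass: "(\<Sum>(m, x)\<in>I \<times> X. G x * w m x) \<le> (\<Sum>(m, x)\<in>I \<times> X. W m x)"
    by (simp add: total_def sum.cartesian_product)
  have "(\<Sum>m\<in>I. \<Sum>x\<in>X. W m x * log 2 (w m x)) = (\<Sum>(m, x)\<in>I \<times> X. W m x * log 2 (G x * w m x / G x))"
    unfolding sum.cartesian_product[symmetric] by (intro sum.cong refl test_term[symmetric])
  also have "\<dots> \<le> (\<Sum>(m, x)\<in>I \<times> X. W m x * log 2 (W m x / G x))"
    using gibbs_inequality[of 2 "I \<times> X" "\<lambda>(m, x). W m x" "\<lambda>(m, x). G x * w m x" "\<lambda>(m, x). G x"] mass
    by (fastforce simp: case_prod_unfold W_nonneg G_nonneg G_pos w_pos less_imp_le)
  finally show ?thesis by (simp add: sum.cartesian_product)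
qed

definition decoding_error :: "'m set \<Rightarrow> 'x set \<Rightarrow> ('m \<Rightarrow> 'x \<Rightarrow> real) \<Rightarrow> ('x \<Rightarrow> 'm) \<Rightarrow> real" where
  "decoding_error I X W d =
     (\<Sum>m\<in>I. \<Sum>x\<in>X. W m x * (if d x \<noteq> m then 1 else 0)) / real (card I)"

lemma decoding_error_le_1:
  assumes "\<And>m x. m \<in> I \<Longrightarrow> x \<in> X \<Longrightarrow> 0 \<le> W m x" "\<And>m. m \<in> I \<Longrightarrow> (\<Sum>x\<in>X. W m x) = 1"
  shows "decoding_error I X W d \<le> 1"
proof -
  have "(\<Sum>m\<in>I. \<Sum>x\<in>X. W m x * (if d x \<noteq> m then 1 else 0)) \<le> (\<Sum>m\<in>I. \<Sum>x\<in>X. W m x)"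
    by (intro sum_mono) (simp add: assms(1))
  also have "\<dots> = real (card I)" using assms(2) by simp
  finally show ?thesis
    unfolding decoding_error_def by (cases "card I = 0") (simp_all add: divide_le_eq)
qed

text \<open>Gibbs' inequality against the test weights \<open>G x * M/2\<close> on correctly decoded pairs and
  \<open>G x * 1/2\<close> elsewhere, \<open>M\<close> being the number of messages, avoids the binary entropy of Fano's
  bound.\<close>
lemma fano_change_of_measure:
  fixes W :: "'m \<Rightarrow> 'x \<Rightarrow> real" and G :: "'x \<Rightarrow> real" and d :: "'x \<Rightarrow> 'm"
  assumes fin: "finite I" and I: "I \<noteq> {}"
    and W_nonneg: "\<And>m x. m \<in> I \<Longrightarrow> x \<in> X \<Longrightarrow> 0 \<le> W m x"
    and W_sum: "\<And>m. m \<in> I \<Longrightarrow> (\<Sum>x\<in>X. W m x) = 1"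
    and G_nonneg: "\<And>x. x \<in> X \<Longrightarrow> 0 \<le> G x" and G_sum: "(\<Sum>x\<in>X. G x) \<le> 1"
    and G_pos: "\<And>m x. m \<in> I \<Longrightarrow> x \<in> X \<Longrightarrow> 0 < W m x \<Longrightarrow> 0 < G x"
  shows "(1 - decoding_error I X W d) * log 2 (real (card I)) - 1
    \<le> (\<Sum>m\<in>I. \<Sum>x\<in>X. W m x * log 2 (W m x / G x)) / real (card I)"
proof -
  define M where "M = real (card I)"
  define w where "w m x = (if d x = m then M / 2 else 1 / 2)" for m x
  have M_pos: "0 < M" using fin I by (simp add: M_def card_gt_0_iff)
  have log_w: "log 2 (w m x) = log 2 M - 1 - log 2 M * (if d x \<noteq> m then 1 else 0)" for m x
    using M_pos by (simp add: w_def log_divide)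
  have w_sum: "(\<Sum>m\<in>I. w m x) \<le> M" for x
  proof -
    have "(\<Sum>m\<in>I. w m x) \<le> (\<Sum>m\<in>I. (if d x = m then M / 2 else 0) + 1 / 2)"
      by (intro sum_mono) (simp add: w_def)
    also have "\<dots> = (\<Sum>m\<in>I. if d x = m then M / 2 else 0) + M / 2"
      by (simp add: sum.distrib M_def)
    also have "\<dots> \<le> M" using M_pos fin by (simp add: sum.delta')
    finally show ?thesis .
  qed
  have "M * ((1 - decoding_error I X W d) * log 2 M - 1) = (\<Sum>m\<in>I. (\<Sum>x\<in>X. W m x) * (log 2 M - 1)
      - log 2 M * (\<Sum>x\<in>X. W m x * (if d x \<noteq> m then 1 else 0)))"
    using M_pos
    by (simp add: W_sum decoding_error_def sum_subtractf right_diff_distrib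
        flip: M_def sum_distrib_left) (simp add: algebra_simps)
  also have "\<dots> = (\<Sum>m\<in>I. \<Sum>x\<in>X. W m x * log 2 (w m x))"
    unfolding log_w sum_distrib_left sum_distrib_right sum_subtractf[symmetric]
    by (intro sum.cong refl) (simp add: algebra_simps)
  also have "\<dots> \<le> (\<Sum>m\<in>I. \<Sum>x\<in>X. W m x * log 2 (W m x / G x))"
    using M_pos w_sum
    by (intro sum_mult_log_le_divergence W_nonneg G_nonneg G_sum G_pos)
      (simp_all add: w_def W_sum M_def)
  finally show ?thesis using M_pos by (simp add: field_simps flip: M_def)
qed

section \<open>Sequential laws\<close>

definition words :: "'a set \<Rightarrow> nat \<Rightarrow> 'a list set" where
  "words A n = {xs. set xs \<subseteq> A \<and> length xs = n}"

definition histories :: "'a set \<Rightarrow> nat \<Rightarrow> 'a list set" where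
  "histories A n = (\<Union>i<n. words A i)"

lemma finite_words [simp]: "finite A \<Longrightarrow> finite (words A n)"
  unfolding words_def by (rule finite_lists_length_eq)

lemma words_0 [simp]: "words A 0 = {[]}"
  by (auto simp: words_def)

lemma snoc_in_words [simp]: "xs @ [x] \<in> words A (Suc n) \<longleftrightarrow> xs \<in> words A n \<and> x \<in> A"
  by (auto simp: words_def)

lemma words_SucE:
  assumes "ys \<in> words A (Suc n)"
  obtains xs x where "ys = xs @ [x]" "xs \<in> words A n" "x \<in> A"
  using assms by (cases ys rule: rev_cases) (auto simp: words_def)

lemma length_words: "xs \<in> words A n \<Longrightarrow> length xs = n"
  by (simp add: words_def)

lemma sum_words_Suc: "(\<Sum>xs\<in>words A (Suc n). g xs) = (\<Sum>xs\<in>words A n. \<Sum>x\<in>A. g (xs @ [x]))"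
proof -
  have "bij_betw (\<lambda>(xs, x). xs @ [x]) (words A n \<times> A) (words A (Suc n))"
    by (rule bij_betw_imageI) (force simp: inj_on_def elim: words_SucE)+
  from sum.reindex_bij_betw[OF this, of g] show ?thesis
    unfolding sum.cartesian_product by (simp add: case_prod_unfold)
qed

lemma in_histories_iff: "xs \<in> histories A n \<longleftrightarrow> set xs \<subseteq> A \<and> length xs < n"
  by (auto simp: histories_def words_def)

lemma Nil_in_histories [simp]: "[] \<in> histories A n \<longleftrightarrow> 0 < n"
  by (simp add: in_histories_iff)

lemma words_in_histories: "xs \<in> words A i \<Longrightarrow> i < n \<Longrightarrow> xs \<in> histories A n"
  by (auto simp: histories_def)

lemma finite_histories [simp]: "finite A \<Longrightarrow> finite (histories A n)"
  by (simp add: histories_def)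

lemma sum_histories:
  "finite A \<Longrightarrow> (\<Sum>xs\<in>histories A n. g xs) = (\<Sum>i<n. \<Sum>xs\<in>words A i. g xs)"
  unfolding histories_def by (rule sum.UNION_disjoint) (simp, simp, auto simp: words_def)

definition path_weight :: "('a list \<Rightarrow> 'a \<Rightarrow> real) \<Rightarrow> 'a list \<Rightarrow> real" where
  "path_weight r xs = (\<Prod>i<length xs. r (take i xs) (xs ! i))"

lemma path_weight_Nil [simp]: "path_weight r [] = 1"
  by (simp add: path_weight_def)

lemma path_weight_snoc: "path_weight r (xs @ [x]) = path_weight r xs * r xs x"
  by (simp add: path_weight_def nth_append)

lemma path_weight_nonneg:
  assumes "\<And>xs x. x \<in> A \<Longrightarrow> 0 \<le> r xs x" "set xs \<subseteq> A"
  shows "0 \<le> path_weight r xs"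
  unfolding path_weight_def using assms by (intro prod_nonneg) (auto dest: nth_mem)

lemma sum_path_weight_le_1:
  assumes r_nonneg: "\<And>xs x. x \<in> A \<Longrightarrow> 0 \<le> r xs x" and r_sum: "\<And>xs. (\<Sum>x\<in>A. r xs x) \<le> 1"
  shows "(\<Sum>xs\<in>words A i. path_weight r xs) \<le> 1"
proof (induction i)
  case 0
  show ?case by simp
next
  case (Suc i)
  have "(\<Sum>xs\<in>words A (Suc i). path_weight r xs)
      = (\<Sum>xs\<in>words A i. path_weight r xs * (\<Sum>x\<in>A. r xs x))"
    by (simp add: sum_words_Suc path_weight_snoc sum_distrib_left)
  also have "\<dots> \<le> (\<Sum>xs\<in>words A i. path_weight r xs)"
    using r_sum path_weight_nonneg[OF r_nonneg]
    by (intro sum_mono mult_left_le) (auto simp: words_def)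
  finally show ?case using Suc by linarith
qed

definition step_divergence :: "'a set \<Rightarrow> ('a list \<Rightarrow> real) \<Rightarrow> ('a list \<Rightarrow> 'a \<Rightarrow> real) \<Rightarrow> 'a list \<Rightarrow> real"
  where "step_divergence A W r xs = (\<Sum>x\<in>A. W (xs @ [x]) * log 2 (W (xs @ [x]) / W xs / r xs x))"

locale sequential_law =
  fixes A :: "'a set" and n :: nat and W :: "'a list \<Rightarrow> real"
  assumes finite_alphabet: "finite A"
    and law_Nil: "W [] = 1"
    and law_nonneg: "0 \<le> W xs"
    and law_split: "xs \<in> histories A n \<Longrightarrow> W xs = (\<Sum>x\<in>A. W (xs @ [x]))"
begin

lemma sum_law: "i \<le> n \<Longrightarrow> (\<Sum>xs\<in>words A i. W xs) = 1"
proof (induction i)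
  case 0
  show ?case by (simp add: law_Nil)
next
  case (Suc i)
  hence "(\<Sum>xs\<in>words A (Suc i). W xs) = (\<Sum>xs\<in>words A i. W xs)"
    unfolding sum_words_Suc
    by (intro sum.cong refl law_split[symmetric] words_in_histories) auto
  thus ?case using Suc by simp
qed

lemma law_snoc_le:
  assumes "xs \<in> histories A n" "x \<in> A"
  shows "W (xs @ [x]) \<le> W xs"
  unfolding law_split[OF assms(1)] using assms(2) finite_alphabet
  by (intro member_le_sum) (auto simp: law_nonneg)

lemma step_divergence_uniform_le:
  assumes "xs \<in> histories A n"
  shows "step_divergence A W (\<lambda>_ _. 1 / real (card A)) xs \<le> W xs * log 2 (real (card A))"
proof -
  have "W (xs @ [x]) * log 2 (W (xs @ [x]) / W xs / (1 / real (card A)))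
      \<le> W (xs @ [x]) * log 2 (real (card A))" if "x \<in> A" for x
  proof (cases "W (xs @ [x]) = 0")
    case False
    hence "0 < W (xs @ [x])" using law_nonneg[of "xs @ [x]"] by simp
    moreover have "0 < real (card A)" using that finite_alphabet by (auto simp: card_gt_0_iff)
    ultimately show ?thesis
      using law_snoc_le[OF assms that] by (simp add: divide_le_eq)
  qed simp
  hence "step_divergence A W (\<lambda>_ _. 1 / real (card A)) xs
      \<le> (\<Sum>x\<in>A. W (xs @ [x]) * log 2 (real (card A)))"
    unfolding step_divergence_def by (rule sum_mono)
  thus ?thesis by (simp add: law_split[OF assms] sum_distrib_right)
qed

lemma sum_step_divergence_uniform_le:
  "(\<Sum>xs\<in>histories A n. step_divergence A W (\<lambda>_ _. 1 / real (card A)) xs)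
    \<le> real n * log 2 (real (card A))"
proof -
  have "(\<Sum>xs\<in>histories A n. step_divergence A W (\<lambda>_ _. 1 / real (card A)) xs)
      \<le> (\<Sum>xs\<in>histories A n. W xs) * log 2 (real (card A))"
    unfolding sum_distrib_right by (intro sum_mono step_divergence_uniform_le)
  also have "(\<Sum>xs\<in>histories A n. W xs) = real n"
    by (simp add: sum_histories finite_alphabet sum_law)
  finally show ?thesis .
qed

context
  fixes r :: "'a list \<Rightarrow> 'a \<Rightarrow> real"
  assumes r_pos: "xs \<in> histories A n \<Longrightarrow> x \<in> A \<Longrightarrow> 0 < W (xs @ [x]) \<Longrightarrow> 0 < r xs x"
begin

lemma path_weight_pos: "xs \<in> words A i \<Longrightarrow> i \<le> n \<Longrightarrow> 0 < W xs \<Longrightarrow> 0 < path_weight r xs"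
proof (induction i arbitrary: xs)
  case 0
  thus ?case by simp
next
  case (Suc i)
  from Suc.prems(1) obtain ys y where ys: "xs = ys @ [y]" "ys \<in> words A i" "y \<in> A"
    by (rule words_SucE)
  have history: "ys \<in> histories A n" using ys(2) Suc.prems(2) by (intro words_in_histories) auto
  have "0 < W ys" using law_snoc_le[OF history ys(3)] Suc.prems(3) ys(1) by simp
  hence "0 < path_weight r ys" using Suc.IH ys(2) Suc.prems(2) by simp
  thus ?case using r_pos[OF history ys(3)] Suc.prems(3) ys(1) by (simp add: path_weight_snoc)
qed

lemma law_snoc_mult_log:
  assumes xs: "xs \<in> words A i" "i < n" and x: "x \<in> A"
  shows "W (xs @ [x]) * log 2 (W (xs @ [x]) / path_weight r (xs @ [x])) =
    W (xs @ [x]) * log 2 (W xs / path_weight r xs)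
    + W (xs @ [x]) * log 2 (W (xs @ [x]) / W xs / r xs x)"
proof (cases "W (xs @ [x]) = 0")
  case False
  hence pos: "0 < W (xs @ [x])" using law_nonneg[of "xs @ [x]"] by simp
  have history: "xs \<in> histories A n" using xs by (rule words_in_histories)
  have "0 < W xs" using law_snoc_le[OF history x] pos by simp
  moreover from this have "0 < path_weight r xs" using path_weight_pos xs by simp
  moreover have "0 < r xs x" by (rule r_pos[OF history x pos])
  ultimately show ?thesis using pos
    by (simp add: path_weight_snoc log_divide log_mult algebra_simps)
qed simp

lemma divergence_chain_rule:
  "i \<le> n \<Longrightarrow> (\<Sum>xs\<in>words A i. W xs * log 2 (W xs / path_weight r xs)) =
    (\<Sum>xs\<in>histories A i. step_divergence A W r xs)"
proof (induction i)
  case 0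
  show ?case by (simp add: law_Nil histories_def)
next
  case (Suc i)
  let ?D = "\<lambda>xs. W xs * log 2 (W xs / path_weight r xs)"
  have "(\<Sum>xs\<in>words A (Suc i). ?D xs) = (\<Sum>xs\<in>words A i.
      (\<Sum>x\<in>A. W (xs @ [x])) * log 2 (W xs / path_weight r xs) + step_divergence A W r xs)"
    unfolding sum_words_Suc step_divergence_def sum_distrib_right sum.distrib[symmetric]
    by (intro sum.cong refl law_snoc_mult_log) (use Suc.prems in auto)
  also have "\<dots> = (\<Sum>xs\<in>words A i. ?D xs + step_divergence A W r xs)"
    using Suc.prems
    by (intro sum.cong refl) (simp add: words_in_histories flip: law_split)
  finally show ?case
    using Suc by (simp add: sum.distrib sum_histories finite_alphabet)
qed

end

end

lemma fano_sequential:
  fixes W :: "'m \<Rightarrow> 'a list \<Rightarrow> real" and d :: "'a list \<Rightarrow> 'm"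
  assumes I: "finite I" "I \<noteq> {}" and law: "\<And>m. m \<in> I \<Longrightarrow> sequential_law A n (W m)"
    and r_nonneg: "\<And>xs x. x \<in> A \<Longrightarrow> 0 \<le> r xs x" and r_sum: "\<And>xs. (\<Sum>x\<in>A. r xs x) \<le> 1"
    and r_pos: "\<And>m xs x. m \<in> I \<Longrightarrow> xs \<in> histories A n \<Longrightarrow> x \<in> A \<Longrightarrow> 0 < W m (xs @ [x]) \<Longrightarrow> 0 < r xs x"
  shows "(1 - decoding_error I (words A n) W d) * log 2 (real (card I)) - 1
    \<le> (\<Sum>m\<in>I. \<Sum>xs\<in>histories A n. step_divergence A (W m) r xs) / real (card I)"
proof -
  have "(1 - decoding_error I (words A n) W d) * log 2 (real (card I)) - 1
      \<le> (\<Sum>m\<in>I. \<Sum>xs\<in>words A n. W m xs * log 2 (W m xs / path_weight r xs)) / real (card I)"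
  proof (rule fano_change_of_measure[OF I])
    show "0 \<le> W m xs" if "m \<in> I" for m xs
      using law[OF that] by (rule sequential_law.law_nonneg)
    show "(\<Sum>xs\<in>words A n. W m xs) = 1" if "m \<in> I" for m
      using law[OF that] by (simp add: sequential_law.sum_law)
    show "0 \<le> path_weight r xs" if "xs \<in> words A n" for xs
      using r_nonneg that by (intro path_weight_nonneg[of A]) (auto simp: words_def)
    show "(\<Sum>xs\<in>words A n. path_weight r xs) \<le> 1"
      using r_nonneg r_sum by (rule sum_path_weight_le_1)
    show "0 < path_weight r xs" if "m \<in> I" "xs \<in> words A n" "0 < W m xs" for m xs
      by (rule sequential_law.path_weight_pos[OF law[OF that(1)] _ that(2) order_refl that(3)])
        (use r_pos that(1) in auto)
  qed
  also have "(\<Sum>m\<in>I. \<Sum>xs\<in>words A n. W m xs * log 2 (W m xs / path_weight r xs))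
      = (\<Sum>m\<in>I. \<Sum>xs\<in>histories A n. step_divergence A (W m) r xs)"
    by (intro sum.cong refl sequential_law.divergence_chain_rule[OF law]) (use r_pos in auto)
  finally show ?thesis .
qed

section \<open>Cyclic Markov chains with a renewal phase\<close>

definition stationary_on :: "'w set \<Rightarrow> ('w \<Rightarrow> 'w \<Rightarrow> real) \<Rightarrow> ('w \<Rightarrow> real) \<Rightarrow> bool" where
  "stationary_on \<Omega> T \<pi> \<longleftrightarrow>
     (\<forall>w\<in>\<Omega>. 0 \<le> \<pi> w) \<and> (\<forall>w. w \<notin> \<Omega> \<longrightarrow> \<pi> w = 0) \<and> (\<Sum>w\<in>\<Omega>. \<pi> w) = 1 \<and>
     (\<forall>w'\<in>\<Omega>. \<pi> w' = (\<Sum>w\<in>\<Omega>. \<pi> w * T w' w))"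

lemma stationary_onD:
  assumes "stationary_on \<Omega> T \<pi>"
  shows "w \<in> \<Omega> \<Longrightarrow> 0 \<le> \<pi> w" "w \<notin> \<Omega> \<Longrightarrow> \<pi> w = 0" "(\<Sum>w\<in>\<Omega>. \<pi> w) = 1"
    "w' \<in> \<Omega> \<Longrightarrow> \<pi> w' = (\<Sum>w\<in>\<Omega>. \<pi> w * T w' w)"
  using assms unfolding stationary_on_def by blast+

lemma stationary_on_reindex:
  assumes bij: "bij_betw h \<Omega> \<Omega>'"
    and T: "\<And>w w'. w \<in> \<Omega> \<Longrightarrow> w' \<in> \<Omega> \<Longrightarrow> T w' w = T' (h w') (h w)"
    and stationary: "stationary_on \<Omega>' T' \<pi>"
  shows "stationary_on \<Omega> T (\<lambda>w. if w \<in> \<Omega> then \<pi> (h w) else 0)"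
proof -
  have h_in: "h w \<in> \<Omega>'" if "w \<in> \<Omega>" for w using bij that by (auto simp: bij_betw_def)
  have sum_\<Omega>': "(\<Sum>w\<in>\<Omega>'. g w) = (\<Sum>w\<in>\<Omega>. g (h w))" for g :: "'b \<Rightarrow> real"
    using sum.reindex_bij_betw[OF bij, of g] by simp
  have "\<pi> (h w') = (\<Sum>w\<in>\<Omega>. \<pi> (h w) * T w' w)" if "w' \<in> \<Omega>" for w'
  proof -
    have "\<pi> (h w') = (\<Sum>w\<in>\<Omega>'. \<pi> w * T' (h w') w)"
      by (rule stationary_onD(4)[OF stationary h_in[OF that]])
    also have "\<dots> = (\<Sum>w\<in>\<Omega>. \<pi> (h w) * T w' w)"
      unfolding sum_\<Omega>' by (intro sum.cong refl) (simp add: T that)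
    finally show ?thesis .
  qed
  hence balance: "\<forall>w'\<in>\<Omega>. (if w' \<in> \<Omega> then \<pi> (h w') else 0) =
      (\<Sum>w\<in>\<Omega>. (if w \<in> \<Omega> then \<pi> (h w) else 0) * T w' w)"
    by (simp cong: sum.cong)
  have "(\<Sum>w\<in>\<Omega>. \<pi> (h w)) = 1" and "\<forall>w\<in>\<Omega>'. 0 \<le> \<pi> w"
    using stationary_onD[OF stationary] unfolding sum_\<Omega>' by blast+
  thus ?thesis unfolding stationary_on_def by (intro conjI balance) (simp_all add: h_in)
qed

lemma stationary_on_reindex_unique:
  assumes bij: "bij_betw h \<Omega> \<Omega>'"
    and T: "\<And>w w'. w \<in> \<Omega> \<Longrightarrow> w' \<in> \<Omega> \<Longrightarrow> T w' w = T' (h w') (h w)"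
    and unique: "\<And>\<rho>. stationary_on \<Omega>' T' \<rho> \<Longrightarrow> \<rho> = \<pi>"
    and stationary: "stationary_on \<Omega> T \<rho>"
  shows "\<rho> = (\<lambda>w. if w \<in> \<Omega> then \<pi> (h w) else 0)"
proof -
  let ?h' = "the_inv_into \<Omega> h"
  have inv: "?h' w' \<in> \<Omega> \<and> h (?h' w') = w'" if "w' \<in> \<Omega>'" for w'
    using bij that by (metis bij_betw_def bij_betw_the_inv_into f_the_inv_into_f imageI)
  have "stationary_on \<Omega>' T' (\<lambda>w'. if w' \<in> \<Omega>' then \<rho> (?h' w') else 0)"
    by (rule stationary_on_reindex[OF bij_betw_the_inv_into[OF bij] _ stationary]) (simp add: T inv)
  hence \<pi>: "(\<lambda>w'. if w' \<in> \<Omega>' then \<rho> (?h' w') else 0) = \<pi>" by (rule unique)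
  have "\<rho> w = \<pi> (h w)" if "w \<in> \<Omega>" for w
    using that bij by (auto simp: the_inv_into_f_f bij_betw_def simp flip: \<pi>)
  moreover have "\<rho> w = 0" if "w \<notin> \<Omega>" for w
    using that by (rule stationary_onD(2)[OF stationary])
  ultimately show ?thesis by auto
qed

locale finite_markov_chain =
  fixes \<Omega> :: "'w set" and T :: "'w \<Rightarrow> 'w \<Rightarrow> real"
  assumes finite_states: "finite \<Omega>"
    and T_nonneg: "w \<in> \<Omega> \<Longrightarrow> w' \<in> \<Omega> \<Longrightarrow> 0 \<le> T w' w"
    and T_sum: "w \<in> \<Omega> \<Longrightarrow> (\<Sum>w'\<in>\<Omega>. T w' w) = 1"

text \<open>The regular states comprise those that are reachable from phase 0; from each of them in the
  last phase the chain restarts with the same law \<open>\<mu>\<close>.\<close>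
locale cyclic_chain = finite_markov_chain \<Omega> T
  for \<Omega> :: "'w set" and T :: "'w \<Rightarrow> 'w \<Rightarrow> real" +
  fixes phase :: "'w \<Rightarrow> nat" and L :: nat and regular :: "'w \<Rightarrow> bool" and \<mu> :: "'w \<Rightarrow> real"
  assumes L_pos: "0 < L"
    and phase_less: "w \<in> \<Omega> \<Longrightarrow> phase w < L"
    and phase_step: "w \<in> \<Omega> \<Longrightarrow> w' \<in> \<Omega> \<Longrightarrow> T w' w \<noteq> 0 \<Longrightarrow> phase w' = Suc (phase w) mod L"
    and regular_0: "w \<in> \<Omega> \<Longrightarrow> phase w = 0 \<Longrightarrow> regular w"
    and regular_step: "w \<in> \<Omega> \<Longrightarrow> w' \<in> \<Omega> \<Longrightarrow> T w' w \<noteq> 0 \<Longrightarrow> regular w \<Longrightarrow> phase w' \<noteq> 0 \<Longrightarrow> regular w'"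
    and renewal: "w \<in> \<Omega> \<Longrightarrow> w' \<in> \<Omega> \<Longrightarrow> Suc (phase w) = L \<Longrightarrow> regular w \<Longrightarrow> phase w' = 0 \<Longrightarrow> T w' w = \<mu> w'"
    and \<mu>_nonneg: "w \<in> \<Omega> \<Longrightarrow> 0 \<le> \<mu> w"
    and \<mu>_sum: "(\<Sum>w | w \<in> \<Omega> \<and> phase w = 0. \<mu> w) = 1"
begin

definition slice :: "nat \<Rightarrow> 'w set" where
  "slice p = {w \<in> \<Omega>. phase w = p}"

lemma sum_slices: "(\<Sum>w\<in>\<Omega>. g w) = (\<Sum>p<L. \<Sum>w\<in>slice p. g w)"
proof -
  have "(\<Union>p<L. slice p) = \<Omega>" using phase_less by (auto simp: slice_def)
  moreover have "(\<Sum>w\<in>(\<Union>p<L. slice p). g w) = (\<Sum>p<L. \<Sum>w\<in>slice p. g w)"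
    by (rule sum.UNION_disjoint) (auto simp: slice_def finite_states)
  ultimately show ?thesis by simp
qed

lemma Suc_mod_inj: "Suc p mod L = Suc p' mod L \<Longrightarrow> p < L \<Longrightarrow> p' < L \<Longrightarrow> p = p'"
  by (auto simp: mod_Suc split: if_splits)

lemma inflow:
  assumes "p < L" "w' \<in> slice (Suc p mod L)"
  shows "(\<Sum>w\<in>\<Omega>. g w * T w' w) = (\<Sum>w\<in>slice p. g w * T w' w)"
proof (rule sum.mono_neutral_right[OF finite_states])
  show "slice p \<subseteq> \<Omega>" by (auto simp: slice_def)
  show "\<forall>w\<in>\<Omega> - slice p. g w * T w' w = 0"
  proof
    fix w assume w: "w \<in> \<Omega> - slice p"
    hence "Suc (phase w) mod L \<noteq> Suc p mod L"
      using Suc_mod_inj[of "phase w" p] phase_less assms(1) by (auto simp: slice_def)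
    thus "g w * T w' w = 0"
      using w assms(2) phase_step[of w w'] by (auto simp: slice_def)
  qed
qed

lemma outflow:
  assumes "w \<in> slice p"
  shows "(\<Sum>w'\<in>slice (Suc p mod L). T w' w) = 1"
proof -
  have "(\<Sum>w'\<in>slice (Suc p mod L). T w' w) = (\<Sum>w'\<in>\<Omega>. T w' w)"
    using assms phase_step[of w] finite_states
    by (intro sum.mono_neutral_left) (auto simp: slice_def)
  thus ?thesis using assms T_sum by (simp add: slice_def)
qed

definition propagates :: "('w \<Rightarrow> real) \<Rightarrow> bool" where
  "propagates g \<longleftrightarrow> (\<forall>w'\<in>\<Omega>. phase w' \<noteq> 0 \<longrightarrow> g w' = (\<Sum>w\<in>\<Omega>. g w * T w' w))"

lemma propagates_slice:
  assumes "propagates g" "w' \<in> slice (Suc p)"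
  shows "g w' = (\<Sum>w\<in>slice p. g w * T w' w)"
proof -
  have w': "w' \<in> \<Omega>" "phase w' = Suc p" using assms(2) by (auto simp: slice_def)
  hence "g w' = (\<Sum>w\<in>\<Omega>. g w * T w' w)"
    using assms(1) unfolding propagates_def by simp
  also have "\<dots> = (\<Sum>w\<in>slice p. g w * T w' w)"
    using assms(2) phase_less[OF w'(1)] w'(2) by (intro inflow) simp_all
  finally show ?thesis .
qed

lemma propagates_mass: "propagates g \<Longrightarrow> p < L \<Longrightarrow> (\<Sum>w\<in>slice p. g w) = (\<Sum>w\<in>slice 0. g w)"
proof (induction p)
  case 0
  show ?case by simp
next
  case (Suc p)
  have "(\<Sum>w'\<in>slice (Suc p). g w') = (\<Sum>w\<in>slice p. g w * (\<Sum>w'\<in>slice (Suc p). T w' w))"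
    by (simp add: propagates_slice[OF Suc.prems(1)] sum.swap[of _ "slice p"] sum_distrib_left)
  also have "\<dots> = (\<Sum>w\<in>slice p. g w)"
    using outflow[of _ p] Suc.prems(2) by simp
  finally show ?case using Suc by simp
qed

lemma propagates_sum:
  assumes "propagates g"
  shows "(\<Sum>w\<in>\<Omega>. g w) = real L * (\<Sum>w\<in>slice 0. g w)"
proof -
  have "(\<Sum>p<L. \<Sum>w\<in>slice p. g w) = (\<Sum>p<L. \<Sum>w\<in>slice 0. g w)"
    by (rule sum.cong[OF refl], rule propagates_mass[OF assms]) simp
  thus ?thesis by (simp add: sum_slices)
qed

lemma propagates_regular:
  assumes "propagates g" "w \<in> \<Omega>" "g w \<noteq> 0"
  shows "regular w"
  using assms(2,3)
proof (induction "phase w" arbitrary: w)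
  case 0
  thus ?case using regular_0 by simp
next
  case (Suc p w')
  hence "g w' = (\<Sum>w\<in>slice p. g w * T w' w)"
    by (intro propagates_slice[OF assms(1)]) (simp add: slice_def)
  then obtain w where "w \<in> slice p" "g w * T w' w \<noteq> 0"
    using Suc.prems by (metis (no_types, lifting) sum.neutral)
  thus ?case using Suc.hyps Suc.prems regular_step[of w w'] by (auto simp: slice_def)
qed

lemma propagates_renewal:
  assumes "propagates g" "w' \<in> slice 0"
  shows "(\<Sum>w\<in>\<Omega>. g w * T w' w) = (\<Sum>w\<in>slice 0. g w) * \<mu> w'"
proof -
  have "(\<Sum>w\<in>\<Omega>. g w * T w' w) = (\<Sum>w\<in>slice (L - 1). g w * T w' w)"
    using assms(2) L_pos by (intro inflow) auto
  also have "\<dots> = (\<Sum>w\<in>slice (L - 1). g w * \<mu> w')"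
  proof (intro sum.cong refl)
    fix w assume w: "w \<in> slice (L - 1)"
    hence "Suc (phase w) = L" using L_pos by (simp add: slice_def)
    thus "g w * T w' w = g w * \<mu> w'"
      using w assms renewal[of w w'] propagates_regular[OF assms(1), of w] by (auto simp: slice_def)
  qed
  finally show ?thesis
    using propagates_mass[OF assms(1), of "L - 1"] L_pos by (simp flip: sum_distrib_right)
qed

lemma propagates_unique:
  assumes "propagates g" "propagates g'" and start: "\<And>w. w \<in> slice 0 \<Longrightarrow> g w = g' w"
  shows "w \<in> slice p \<Longrightarrow> g w = g' w"
proof (induction p arbitrary: w)
  case 0
  thus ?case by (rule start)
next
  case (Suc p)
  hence "(\<Sum>w'\<in>slice p. g w' * T w w') = (\<Sum>w'\<in>slice p. g' w' * T w w')"
    by (intro sum.cong refl) simp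
  thus ?case by (simp only: propagates_slice[OF _ Suc.prems] assms(1,2))
qed

lemma stationary_on_propagates: "stationary_on \<Omega> T \<pi> \<Longrightarrow> propagates \<pi>"
  unfolding stationary_on_def propagates_def by blast

lemma stationary_on_renewal:
  assumes "stationary_on \<Omega> T \<pi>" "w \<in> \<Omega>" "phase w = 0"
  shows "\<pi> w = \<mu> w / real L"
proof -
  note propagates = stationary_on_propagates[OF assms(1)]
  have "(\<Sum>w\<in>slice 0. \<pi> w) = 1 / real L"
    using propagates_sum[OF propagates] stationary_onD(3)[OF assms(1)] L_pos
    by (simp add: field_simps)
  moreover have "(\<Sum>w'\<in>\<Omega>. \<pi> w' * T w w') = (\<Sum>w\<in>slice 0. \<pi> w) * \<mu> w"
    using assms(2,3) by (intro propagates_renewal propagates) (simp add: slice_def)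
  ultimately show ?thesis
    by (subst stationary_onD(4)[OF assms(1,2)]) simp
qed

primrec phase_law :: "nat \<Rightarrow> 'w \<Rightarrow> real" where
  "phase_law 0 w = \<mu> w"
| "phase_law (Suc p) w' = (\<Sum>w\<in>slice p. phase_law p w * T w' w)"

lemma phase_law_nonneg: "w \<in> slice p \<Longrightarrow> 0 \<le> phase_law p w"
  by (induction p arbitrary: w)
    (auto simp: slice_def \<mu>_nonneg T_nonneg intro!: sum_nonneg mult_nonneg_nonneg)

definition stationary_law :: "'w \<Rightarrow> real" where
  "stationary_law w = (if w \<in> \<Omega> then phase_law (phase w) w / real L else 0)"

lemma propagates_stationary_law: "propagates stationary_law"
  unfolding propagates_def
proof (intro ballI impI)
  fix w' assume "w' \<in> \<Omega>" "phase w' \<noteq> 0"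
  then obtain p where w': "w' \<in> slice (Suc p)" "Suc p < L"
    using phase_less[of w'] by (cases "phase w'") (auto simp: slice_def)
  hence "(\<Sum>w\<in>\<Omega>. stationary_law w * T w' w) = (\<Sum>w\<in>slice p. stationary_law w * T w' w)"
    by (intro inflow) auto
  also have "\<dots> = (\<Sum>w\<in>slice p. phase_law p w * T w' w / real L)"
    by (intro sum.cong refl) (simp add: stationary_law_def slice_def)
  also have "\<dots> = stationary_law w'"
    using w' by (simp add: stationary_law_def slice_def sum_divide_distrib)
  finally show "stationary_law w' = (\<Sum>w\<in>\<Omega>. stationary_law w * T w' w)" ..
qed

lemma stationary_on_stationary_law: "stationary_on \<Omega> T stationary_law"
proof -
  have mass_0: "(\<Sum>w\<in>slice 0. stationary_law w) = 1 / real L"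
    using \<mu>_sum by (simp add: stationary_law_def slice_def flip: sum_divide_distrib)
  show ?thesis unfolding stationary_on_def
  proof (intro conjI ballI allI impI)
    show "(\<Sum>w\<in>\<Omega>. stationary_law w) = 1"
      using L_pos by (simp add: propagates_sum[OF propagates_stationary_law] mass_0)
    fix w' assume w': "w' \<in> \<Omega>"
    show "stationary_law w' = (\<Sum>w\<in>\<Omega>. stationary_law w * T w' w)"
    proof (cases "phase w' = 0")
      case True
      hence "(\<Sum>w\<in>\<Omega>. stationary_law w * T w' w) = 1 / real L * \<mu> w'"
        using w' mass_0 by (subst propagates_renewal[OF propagates_stationary_law])
          (simp_all add: slice_def)
      thus ?thesis using w' True by (simp add: stationary_law_def)
    next
      case False
      thus ?thesis using propagates_stationary_law w' unfolding propagates_def by blast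
    qed
  qed (auto simp: stationary_law_def slice_def phase_law_nonneg)
qed

lemma stationary_law_unique:
  assumes "stationary_on \<Omega> T \<pi>"
  shows "\<pi> = stationary_law"
proof
  fix w
  show "\<pi> w = stationary_law w"
  proof (cases "w \<in> \<Omega>")
    case True
    have "\<pi> w = stationary_law w" if "w \<in> slice 0" for w
      using that stationary_on_renewal[OF assms]
        stationary_on_renewal[OF stationary_on_stationary_law]
      by (simp add: slice_def)
    thus ?thesis
      using propagates_unique[OF stationary_on_propagates[OF assms] propagates_stationary_law] True
      by (simp add: slice_def)
  next
    case False
    thus ?thesis using stationary_onD(2)[OF assms] by (simp add: stationary_law_def)
  qed
qed

lemmas stationary_law_renewal = stationary_on_renewal[OF stationary_on_stationary_law]

lemmas stationary_law_regular = propagates_regular[OF propagates_stationary_law]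

end

section \<open>Policies over an arbitrary alphabet\<close>

lemma gU_le: "gU N q x \<le> N"
  by (simp add: gU_def)

lemma PU_nonneg: "0 \<le> \<eta> \<Longrightarrow> \<eta> \<le> 1 \<Longrightarrow> 0 \<le> PU \<eta> N x s q s'"
  by (simp add: PU_def behc_law_def Let_def)

lemma sum_PU: "(\<Sum>s'\<in>{0, 1}. PU \<eta> N x s q s') = 1"
  by (simp add: PU_def behc_law_def Let_def)

locale strategy_policy =
  fixes \<eta> :: real and N :: nat and U :: "'u set" and f :: "'u \<Rightarrow> nat \<Rightarrow> nat"
    and P :: "'u \<Rightarrow> 'u \<Rightarrow> nat \<Rightarrow> real"
  assumes eta: "0 \<le> \<eta>" "\<eta> \<le> 1"
    and finite_alphabet: "finite U" and alphabet_nonempty: "U \<noteq> {}"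
    and f_binary: "u \<in> U \<Longrightarrow> s \<in> {0, 1} \<Longrightarrow> f u s \<in> {0, 1}" and f_0: "u \<in> U \<Longrightarrow> f u 0 = 0"
    and P_nonneg: "u \<in> U \<Longrightarrow> u' \<in> U \<Longrightarrow> q \<le> N \<Longrightarrow> 0 \<le> P u' u q"
    and P_sum: "u \<in> U \<Longrightarrow> q \<le> N \<Longrightarrow> (\<Sum>u'\<in>U. P u' u q) = 1"
begin

definition states :: "(nat \<times> 'u \<times> nat) set" where
  "states = {0, 1} \<times> U \<times> {0..N}"

fun kernel :: "nat \<times> 'u \<times> nat \<Rightarrow> nat \<times> 'u \<times> nat \<Rightarrow> real" where
  "kernel (s', u', q') (s, u, q) =
     (if q' = gU N q (f u' s) then P u' u q * PU \<eta> N (f u' s) s q s' else 0)"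

definition joint :: "(nat \<times> 'u \<times> nat \<Rightarrow> real) \<Rightarrow> 'u \<times> 'u \<Rightarrow> nat \<Rightarrow> nat \<Rightarrow> real" where
  "joint \<pi> = (\<lambda>(u', u) x q. \<Sum>s\<in>{0, 1}. if x = f u' s then \<pi> (s, u, q) * P u' u q else 0)"

lemma sum_states: "(\<Sum>w\<in>states. g w) = (\<Sum>s\<in>{0, 1}. \<Sum>u\<in>U. \<Sum>q\<in>{0..N}. g (s, u, q))"
  unfolding states_def sum.cartesian_product by (simp add: case_prod_unfold)

sublocale finite_markov_chain states kernel
proof
  show "finite states" by (simp add: states_def finite_alphabet)
  show "0 \<le> kernel w' w" if "w \<in> states" "w' \<in> states" for w w'
    using that by (auto simp: states_def P_nonneg PU_nonneg eta)
  fix w assume "w \<in> states"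
  then obtain s u q where w: "w = (s, u, q)" "u \<in> U" "q \<le> N" by (auto simp: states_def)
  have "(\<Sum>w'\<in>states. kernel w' w) = (\<Sum>s'\<in>{0, 1}. \<Sum>u'\<in>U. P u' u q * PU \<eta> N (f u' s) s q s')"
    unfolding sum_states w(1) by (simp add: sum.delta gU_le)
  also have "\<dots> = (\<Sum>u'\<in>U. P u' u q * (\<Sum>s'\<in>{0, 1}. PU \<eta> N (f u' s) s q s'))"
    by (subst sum.swap) (simp only: sum_distrib_left)
  also have "\<dots> = 1" unfolding sum_PU using w by (simp add: P_sum)
  finally show "(\<Sum>w'\<in>states. kernel w' w) = 1" .
qed

lemma kernelT_eq_kernel:
  assumes "\<And>u. u < k \<Longrightarrow> h u \<in> U" "w \<in> Omega k N" "w' \<in> Omega k N"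
  shows "kernelT \<eta> N (\<lambda>u. f (h u)) (\<lambda>u' u. P (h u') (h u)) w' w
    = kernel (map_prod id (map_prod h id) w') (map_prod id (map_prod h id) w)"
proof -
  obtain s u q s' u' q' where w: "w = (s, u, q)" "w' = (s', u', q')" "s \<in> {0, 1}" "u' < k"
    using assms(2,3) by (auto simp: Omega_def)
  have "f (h u') s = 0 \<or> f (h u') s = 1" using f_binary[OF assms(1), of u' s] w by auto
  thus ?thesis unfolding w by (elim disjE) (simp_all add: kernelT_def)
qed

lemma joint_uux_q_eq_joint:
  assumes "\<And>s. s \<in> {0, 1} \<Longrightarrow> \<pi>' (s, u, q) = \<pi> (s, h u, q)"
  shows "joint_uux_q \<eta> N (\<lambda>u. f (h u)) (\<lambda>u' u. P (h u') (h u)) \<pi>' (u', u) x q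
    = joint \<pi> (h u', h u) x q"
proof -
  have counter: "(\<Sum>q'\<in>{0..N}. if q' = gU N q x then 1 else 0) = (1 :: real)"
    by (simp add: sum.delta gU_le)
  show ?thesis
    unfolding joint_uux_q_def joint_def prod.case
    unfolding sum_distrib_left[symmetric] counter sum_PU mult_1_right
    by (intro sum.cong refl) (simp add: assms)
qed

lemma valid_f_reindex: "(\<And>u. u < k \<Longrightarrow> h u \<in> U) \<Longrightarrow> valid_f k (\<lambda>u. f (h u))"
  using f_binary f_0 by (simp add: valid_f_def)

lemma valid_policy_reindex:
  assumes "bij_betw h {0..<k} U"
  shows "valid_policy k N (\<lambda>u' u. P (h u') (h u))"
proof -
  have "h u \<in> U" if "u < k" for u using assms that by (auto simp: bij_betw_def)
  moreover have "(\<Sum>u'\<in>{0..<k}. P (h u') (h u) q) = (\<Sum>u'\<in>U. P u' (h u) q)" for u q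
    by (rule sum.reindex_bij_betw[OF assms])
  ultimately show ?thesis by (simp add: valid_policy_def P_nonneg P_sum)
qed

lemma bij_betw_Omega_states:
  assumes "bij_betw h {0..<k} U"
  shows "bij_betw (map_prod id (map_prod h id)) (Omega k N) states"
  unfolding Omega_def states_def by (intro bij_betw_map_prod assms bij_betw_id)

lemma stationary_iff_stationary_on:
  "stationary \<eta> N k f' P' \<pi> \<longleftrightarrow> stationary_on (Omega k N) (kernelT \<eta> N f' P') \<pi>"
  unfolding stationary_def stationary_on_def ..

end

locale stationary_policy = strategy_policy +
  fixes \<pi> :: "nat \<times> 'a \<times> nat \<Rightarrow> real"
  assumes stationary: "stationary_on states kernel \<pi>"
    and unique: "stationary_on states kernel \<rho> \<Longrightarrow> \<rho> = \<pi>"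
begin

lemma stationary_reindex_iff:
  assumes h: "bij_betw h {0..<k} U"
  shows "stationary \<eta> N k (\<lambda>u. f (h u)) (\<lambda>u' u. P (h u') (h u)) \<rho> \<longleftrightarrow>
    \<rho> = (\<lambda>w. if w \<in> Omega k N then \<pi> (map_prod id (map_prod h id) w) else 0)"
proof
  have kernel_eq: "kernelT \<eta> N (\<lambda>u. f (h u)) (\<lambda>u' u. P (h u') (h u)) w' w
      = kernel (map_prod id (map_prod h id) w') (map_prod id (map_prod h id) w)"
    if "w \<in> Omega k N" "w' \<in> Omega k N" for w w'
    using h that by (intro kernelT_eq_kernel) (auto simp: bij_betw_def)
  note states_bij = bij_betw_Omega_states[OF h]
  show "\<rho> = (\<lambda>w. if w \<in> Omega k N then \<pi> (map_prod id (map_prod h id) w) else 0)"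
    if "stationary \<eta> N k (\<lambda>u. f (h u)) (\<lambda>u' u. P (h u') (h u)) \<rho>"
    using states_bij kernel_eq unique that[unfolded stationary_iff_stationary_on]
    by (rule stationary_on_reindex_unique)
  show "stationary \<eta> N k (\<lambda>u. f (h u)) (\<lambda>u' u. P (h u') (h u)) \<rho>"
    if "\<rho> = (\<lambda>w. if w \<in> Omega k N then \<pi> (map_prod id (map_prod h id) w) else 0)"
    unfolding that stationary_iff_stationary_on
    using states_bij kernel_eq stationary by (rule stationary_on_reindex)
qed

lemma cond_mi_joint_le_upper_bound:
  "ereal (cond_mi (U \<times> U) {0, 1} {0..N} (joint \<pi>)) \<le> upper_bound \<eta> N"
proof -
  define k where "k = card U"
  obtain h where h: "bij_betw h {0..<k} U"
    using ex_bij_betw_nat_finite[OF finite_alphabet] by (auto simp: k_def)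
  define f' where "f' u = f (h u)" for u
  define P' where "P' u' u = P (h u') (h u)" for u' u
  define \<pi>' where "\<pi>' w = (if w \<in> Omega k N then \<pi> (map_prod id (map_prod h id) w) else 0)" for w
  have stationary_eq: "stationary \<eta> N k f' P' = (\<lambda>\<rho>. \<rho> = \<pi>')"
    unfolding f'_def P'_def \<pi>'_def by (intro ext stationary_reindex_iff h)
  have "cond_mi (U \<times> U) {0, 1} {0..N} (joint \<pi>)
      = cond_mi ({0..<k} \<times> {0..<k}) {0, 1} {0..N} (joint_uux_q \<eta> N f' P' \<pi>')"
  proof (rule cond_mi_reindex[OF bij_betw_map_prod[OF h h], symmetric])
    fix uu x q assume "uu \<in> {0..<k} \<times> {0..<k}" "q \<in> {0..N}"
    thus "joint_uux_q \<eta> N f' P' \<pi>' uu x q = joint \<pi> (map_prod h h uu) x q"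
      unfolding f'_def P'_def
      by (cases uu) (auto simp: \<pi>'_def Omega_def intro!: joint_uux_q_eq_joint)
  qed
  moreover have "1 \<le> k"
    using finite_alphabet alphabet_nonempty by (simp add: k_def Suc_le_eq card_gt_0_iff)
  moreover have "valid_f k f'"
    unfolding f'_def using h by (intro valid_f_reindex) (auto simp: bij_betw_def)
  moreover have "valid_policy k N P'"
    unfolding P'_def using h by (rule valid_policy_reindex)
  ultimately show ?thesis
    unfolding upper_bound_def
    by (intro Sup_upper CollectI exI[of _ k] exI[of _ f'] exI[of _ P']) (simp add: stationary_eq)
qed

lemma \<pi>_nonneg: "s \<in> {0, 1} \<Longrightarrow> u \<in> U \<Longrightarrow> q \<le> N \<Longrightarrow> 0 \<le> \<pi> (s, u, q)"
  by (rule stationary_onD(1)[OF stationary]) (simp add: states_def)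

text \<open>\<open>selected u' s q\<close> and \<open>emitted u' x q\<close> are the probabilities of \<open>(U\<^sup>+, S, Q) = (u', s, q)\<close> and
  \<open>(U\<^sup>+, X, Q) = (u', x, q)\<close>.\<close>
definition selected :: "'a \<Rightarrow> nat \<Rightarrow> nat \<Rightarrow> real" where
  "selected u' s q = (\<Sum>u\<in>U. \<pi> (s, u, q) * P u' u q)"

definition emitted :: "'a \<Rightarrow> nat \<Rightarrow> nat \<Rightarrow> real" where
  "emitted u' x q = (\<Sum>s\<in>{0, 1}. if x = f u' s then selected u' s q else 0)"

definition output_law :: "nat \<Rightarrow> nat \<Rightarrow> real" where
  "output_law q x = cond_marginal (U \<times> U) {0, 1} (joint \<pi>) x q"

lemma selected_nonneg: "u' \<in> U \<Longrightarrow> s \<in> {0, 1} \<Longrightarrow> q \<le> N \<Longrightarrow> 0 \<le> selected u' s q"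
  unfolding selected_def by (intro sum_nonneg mult_nonneg_nonneg \<pi>_nonneg P_nonneg)

lemma emitted_nonneg: "u' \<in> U \<Longrightarrow> q \<le> N \<Longrightarrow> 0 \<le> emitted u' x q"
  unfolding emitted_def by (intro sum_nonneg) (simp add: selected_nonneg)

lemma stationary_step:
  assumes "u' \<in> U" "s' \<in> {0, 1}" "q' \<le> N"
  shows "\<pi> (s', u', q') = (\<Sum>s\<in>{0, 1}. \<Sum>q\<in>{0..N}.
    if q' = gU N q (f u' s) then selected u' s q * PU \<eta> N (f u' s) s q s' else 0)"
proof -
  have "(s', u', q') \<in> states" using assms by (simp add: states_def)
  hence "\<pi> (s', u', q') = (\<Sum>w\<in>states. \<pi> w * kernel (s', u', q') w)"
    by (rule stationary_onD(4)[OF stationary])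
  also have "\<dots> = (\<Sum>s\<in>{0, 1}. \<Sum>u\<in>U. \<Sum>q\<in>{0..N}. \<pi> (s, u, q) * kernel (s', u', q') (s, u, q))"
    by (rule sum_states)
  also have "\<dots> = (\<Sum>s\<in>{0, 1}. \<Sum>q\<in>{0..N}. \<Sum>u\<in>U. \<pi> (s, u, q) * kernel (s', u', q') (s, u, q))"
    by (intro sum.cong[OF refl] sum.swap)
  also have "\<dots> = (\<Sum>s\<in>{0, 1}. \<Sum>q\<in>{0..N}.
      if q' = gU N q (f u' s) then selected u' s q * PU \<eta> N (f u' s) s q s' else 0)"
    by (intro sum.cong refl) (simp add: selected_def sum_distrib_right mult.assoc)
  finally show ?thesis .
qed

lemma joint_nonneg: "uu \<in> U \<times> U \<Longrightarrow> q \<le> N \<Longrightarrow> 0 \<le> joint \<pi> uu x q"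
  by (auto simp: joint_def intro!: add_nonneg_nonneg mult_nonneg_nonneg \<pi>_nonneg P_nonneg)

lemma sum_joint: "(\<Sum>u\<in>U. joint \<pi> (u', u) x q) = emitted u' x q"
  unfolding emitted_def selected_def joint_def prod.case
  by (subst sum.swap) (auto intro!: sum.cong)

lemma sum_joint_pairs:
  "(\<Sum>uu\<in>U \<times> U. joint \<pi> uu x q * g (fst uu)) = (\<Sum>u\<in>U. emitted u x q * g u)"
  unfolding sum_joint[symmetric] sum_distrib_right sum.cartesian_product
  by (simp add: case_prod_unfold)

lemma output_law_nonneg: "q \<le> N \<Longrightarrow> x \<in> {0, 1} \<Longrightarrow> 0 \<le> output_law q x"
  unfolding output_law_def by (intro cond_marginal_nonneg joint_nonneg)

lemma sum_output_law_le_1: "(\<Sum>x\<in>{0, 1}. output_law q x) \<le> 1"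
  unfolding output_law_def by (rule sum_cond_marginal_le_1)

lemma output_law_pos:
  assumes "u \<in> U" "x \<in> {0, 1}" "q \<le> N" "0 < emitted u x q"
  shows "0 < output_law q x"
  unfolding output_law_def
proof (rule cond_marginal_pos)
  have "0 < (\<Sum>u\<in>U. emitted u x q)"
    using assms by (intro sum_pos2[of U u] finite_alphabet emitted_nonneg)
  thus "0 < (\<Sum>uu\<in>U \<times> U. joint \<pi> uu x q)"
    using sum_joint_pairs[of x q "\<lambda>_. 1"] by simp
qed (use assms joint_nonneg in auto)

definition information_gain :: "('a \<Rightarrow> nat \<Rightarrow> real) \<Rightarrow> 'a \<Rightarrow> real" where
  "information_gain \<rho> u =
     (\<Sum>x\<in>{0, 1}. \<Sum>q\<in>{0..N}. emitted u x q * log 2 (\<rho> u x / output_law q x))"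

lemma information_gain_nonneg:
  assumes u: "u \<in> U"
    and sure: "\<And>x q. x \<in> {0, 1} \<Longrightarrow> q \<le> N \<Longrightarrow> emitted u x q \<noteq> 0 \<Longrightarrow> \<rho> u x = 1"
  shows "0 \<le> information_gain \<rho> u"
  unfolding information_gain_def
proof (intro sum_nonneg)
  fix x q assume "x \<in> {0, 1 :: nat}" "q \<in> {0..N}"
  hence x: "x \<in> {0, 1}" and q: "q \<le> N" by auto
  show "0 \<le> emitted u x q * log 2 (\<rho> u x / output_law q x)"
  proof (cases "emitted u x q = 0")
    case False
    hence pos: "0 < emitted u x q" using emitted_nonneg[OF u q, of x] by simp
    have "output_law q x \<le> (\<Sum>x\<in>{0, 1}. output_law q x)"
      using x q by (intro member_le_sum output_law_nonneg) auto
    hence "output_law q x \<le> 1" using sum_output_law_le_1[of q] by linarith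
    thus ?thesis using pos output_law_pos[OF u x q pos] sure[OF x q False] by simp
  qed simp
qed

lemma sum_information_gain_le_upper_bound:
  assumes \<rho>_nonneg: "\<And>u x. u \<in> U \<Longrightarrow> x \<in> {0, 1} \<Longrightarrow> 0 \<le> \<rho> u x"
    and \<rho>_sum: "\<And>u. u \<in> U \<Longrightarrow> (\<Sum>x\<in>{0, 1}. \<rho> u x) \<le> 1"
    and \<rho>_pos: "\<And>u x q. u \<in> U \<Longrightarrow> x \<in> {0, 1} \<Longrightarrow> q \<le> N \<Longrightarrow> 0 < emitted u x q \<Longrightarrow> 0 < \<rho> u x"
  shows "ereal (\<Sum>u\<in>U. information_gain \<rho> u) \<le> upper_bound \<eta> N"
proof -
  let ?g = "\<lambda>u x q. log 2 (\<rho> u x / output_law q x)"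
  have "(\<Sum>u\<in>U. information_gain \<rho> u) = (\<Sum>x\<in>{0, 1}. \<Sum>q\<in>{0..N}. \<Sum>u\<in>U. emitted u x q * ?g u x q)"
    unfolding information_gain_def by (subst sum.swap) (intro sum.cong[OF refl] sum.swap)
  also have "\<dots> = (\<Sum>x\<in>{0, 1}. \<Sum>q\<in>{0..N}. \<Sum>uu\<in>U \<times> U. joint \<pi> uu x q * ?g (fst uu) x q)"
    by (intro sum.cong refl sum_joint_pairs[symmetric])
  also have "\<dots> = (\<Sum>uu\<in>U \<times> U. \<Sum>x\<in>{0, 1}. \<Sum>q\<in>{0..N}. joint \<pi> uu x q * ?g (fst uu) x q)"
    by (subst sum.swap[of _ "U \<times> U"]) (intro sum.cong[OF refl] sum.swap)
  also have "\<dots> \<le> cond_mi (U \<times> U) {0, 1} {0..N} (joint \<pi>)"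
    unfolding output_law_def
  proof (rule cond_mi_ge_test_law)
    fix uu x q assume in_alphabets: "uu \<in> U \<times> U" "x \<in> {0, 1 :: nat}" "q \<in> {0..N}"
      and pos: "0 < joint \<pi> uu x q"
    obtain u' u where u: "uu = (u', u)" "u' \<in> U" "u \<in> U" using in_alphabets by auto
    have "0 < emitted u' x q"
      unfolding sum_joint[symmetric] using in_alphabets pos u
      by (intro sum_pos2[of U u] finite_alphabet joint_nonneg) auto
    thus "0 < \<rho> (fst uu) x" using \<rho>_pos u in_alphabets by simp
  qed (use \<rho>_nonneg \<rho>_sum joint_nonneg finite_alphabet in auto)
  finally show ?thesis using cond_mi_joint_le_upper_bound by (meson ereal_less_eq(3) order_trans)
qed

end

section \<open>The input law of a code\<close>

lemma state_seqs_eq_words: "state_seqs n = words {0, 1} n"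
  by (auto simp: state_seqs_def words_def)

lemma length_enc_x [simp]: "length (enc_x e m sl i) = i"
  by (induction i) (auto simp: Let_def)

lemma enc_x_append: "i \<le> Suc (length sl) \<Longrightarrow> enc_x e m (sl @ sl') i = enc_x e m sl i"
  by (induction i) (auto simp: Let_def)

lemma take_enc_x: "j \<le> i \<Longrightarrow> take j (enc_x e m sl i) = enc_x e m sl j"
  by (induction i) (auto simp: Let_def le_Suc_eq)

lemma nth_enc_x: "j < i \<Longrightarrow> enc_x e m sl i ! j = e (Suc j) m (take j sl) (enc_x e m sl j)"
  by (induction i) (auto simp: Let_def nth_append less_Suc_eq)

lemma q_after_Nil [simp]: "q_after N [] = 0"
  by (simp add: q_after_def)

lemma q_after_snoc: "q_after N (xs @ [x]) = gU N (q_after N xs) x"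
  by (simp add: q_after_def)

lemma q_after_le: "q_after N xs \<le> N"
  by (cases xs rule: rev_cases) (simp_all add: q_after_snoc gU_le)

lemma state_prob_eq_prod:
  "state_prob \<eta> N e i m sl = (\<Prod>j<i. PU \<eta> N (e (Suc j) m (take j sl) (enc_x e m sl j)) ((0 # sl) ! j)
     (q_after N (enc_x e m sl j)) (sl ! j))"
  unfolding state_prob_def Let_def One_nat_def prod.atLeast1_atMost_eq
  by (intro prod.cong refl) (simp add: nth_enc_x take_enc_x)

text \<open>An input 0 is made with weight \<open>w\<close>, of which \<open>d\<close> has a full battery before the step; the
  result is the weight that has a full battery afterwards.\<close>
definition idle_charge :: "real \<Rightarrow> nat \<Rightarrow> nat \<Rightarrow> real \<Rightarrow> real \<Rightarrow> real" where
  "idle_charge \<eta> N q w d = d * PU \<eta> N 0 1 q 1 + (w - d) * PU \<eta> N 0 0 q 1"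

lemma idle_charge_mono:
  assumes "\<eta> \<le> 1" "d \<le> d'"
  shows "idle_charge \<eta> N q w d \<le> idle_charge \<eta> N q w d'"
proof -
  have "PU \<eta> N 0 0 q 1 \<le> PU \<eta> N 0 1 q 1" using assms(1) by (simp add: PU_def behc_law_def)
  hence "0 \<le> (d' - d) * (PU \<eta> N 0 1 q 1 - PU \<eta> N 0 0 q 1)" using assms(2) by simp
  thus ?thesis by (simp add: idle_charge_def algebra_simps)
qed

locale boosted_code =
  fixes \<eta> :: real and N :: nat and e :: "nat \<Rightarrow> nat \<Rightarrow> nat list \<Rightarrow> nat list \<Rightarrow> nat" and n M :: nat
  assumes eta: "0 \<le> \<eta>" "\<eta> \<le> 1" and valid: "valid_code N e n M"
begin

definition battery :: "nat list \<Rightarrow> nat" where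
  "battery sl = last (0 # sl)"

definition inputs :: "nat \<Rightarrow> nat list \<Rightarrow> nat list" where
  "inputs m sl = enc_x e m sl (length sl)"

definition next_input :: "nat \<Rightarrow> nat list \<Rightarrow> nat" where
  "next_input m sl = e (Suc (length sl)) m sl (inputs m sl)"

definition weight :: "nat \<Rightarrow> nat list \<Rightarrow> real" where
  "weight m sl = state_prob \<eta> N e (length sl) m sl"

definition expect_on_inputs :: "nat \<Rightarrow> (nat list \<Rightarrow> real) \<Rightarrow> nat list \<Rightarrow> real" where
  "expect_on_inputs m \<phi> xs =
     (\<Sum>sl\<in>words {0, 1} (length xs). of_bool (inputs m sl = xs) * weight m sl * \<phi> sl)"

definition input_law :: "nat \<Rightarrow> nat list \<Rightarrow> real" where
  "input_law m = expect_on_inputs m (\<lambda>_. 1)"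

definition charged :: "nat \<Rightarrow> nat list \<Rightarrow> real" where
  "charged m = expect_on_inputs m (\<lambda>sl. of_bool (battery sl = 1))"

lemma battery_binary: "sl \<in> words {0, 1} i \<Longrightarrow> battery sl \<in> {0, 1}"
  by (cases sl rule: rev_cases) (auto simp: words_def battery_def)

lemma next_input_le_battery:
  assumes m: "m \<in> {1..M}" and sl: "sl \<in> words {0, 1} i" and i: "i < n"
  shows "next_input m sl \<le> battery sl"
proof -
  let ?sl = "sl @ replicate (n - i) 0"
  have len: "length sl = i" using sl by (rule length_words)
  have "?sl \<in> state_seqs n" using sl i by (auto simp: words_def state_seqs_def)
  moreover have "Suc i \<in> {1..n}" using i by simp
  ultimately have "enc_x e m ?sl n ! (Suc i - 1) \<le> (0 # ?sl) ! (Suc i - 1)"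
    using valid m unfolding valid_code_def by blast
  also have "enc_x e m ?sl n ! (Suc i - 1) = next_input m sl"
    using i len by (simp add: nth_enc_x enc_x_append next_input_def inputs_def)
  also have "(0 # ?sl) ! (Suc i - 1) = battery sl"
    using len by (auto simp: battery_def nth_Cons last_conv_nth nth_append split: nat.splits)
  finally show ?thesis .
qed

lemma next_input_binary:
  "m \<in> {1..M} \<Longrightarrow> sl \<in> words {0, 1} i \<Longrightarrow> i < n \<Longrightarrow> next_input m sl \<in> {0, 1}"
  using next_input_le_battery[of m sl i] battery_binary[of sl i] by auto

lemma inputs_snoc: "inputs m (sl @ [s]) = inputs m sl @ [next_input m sl]"
  by (simp add: inputs_def next_input_def Let_def enc_x_append)

lemma inputs_in_words: "m \<in> {1..M} \<Longrightarrow> sl \<in> words {0, 1} i \<Longrightarrow> i \<le> n \<Longrightarrow> inputs m sl \<in> words {0, 1} i"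
proof (induction i arbitrary: sl)
  case 0
  thus ?case by (simp add: inputs_def)
next
  case (Suc i)
  from Suc.prems(2) obtain sl' s where "sl = sl' @ [s]" "sl' \<in> words {0, 1} i"
    by (rule words_SucE)
  thus ?case using Suc next_input_binary[of m sl' i] by (simp add: inputs_snoc)
qed

lemma weight_nonneg: "0 \<le> weight m sl"
  using eta by (auto simp: weight_def state_prob_eq_prod intro!: prod_nonneg PU_nonneg)

lemma weight_snoc:
  "weight m (sl @ [s])
    = weight m sl * PU \<eta> N (next_input m sl) (battery sl) (q_after N (inputs m sl)) s"
proof -
  define factor where "factor ss j =
      PU \<eta> N (e (Suc j) m (take j ss) (enc_x e m ss j)) ((0 # ss) ! j)
        (q_after N (enc_x e m ss j)) (ss ! j)" for ss j
  have "factor (sl @ [s]) j = factor sl j" if "j < length sl" for j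
    using that by (cases j) (simp_all add: factor_def enc_x_append nth_append)
  moreover have "(0 # sl @ [s]) ! length sl = battery sl"
    by (auto simp: battery_def nth_Cons last_conv_nth nth_append split: nat.splits)
  ultimately show ?thesis
    by (simp add: weight_def state_prob_eq_prod factor_def[symmetric])
      (simp add: factor_def inputs_def next_input_def enc_x_append)
qed

lemma expect_on_inputs_mono:
  assumes "\<And>sl. sl \<in> words {0, 1} (length xs) \<Longrightarrow> \<phi> sl \<le> \<psi> sl"
  shows "expect_on_inputs m \<phi> xs \<le> expect_on_inputs m \<psi> xs"
  unfolding expect_on_inputs_def by (intro sum_mono) (simp add: assms mult_left_mono weight_nonneg)

lemma expect_on_inputs_cong:
  assumes "\<And>sl. sl \<in> words {0, 1} (length xs) \<Longrightarrow> \<phi> sl = \<psi> sl"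
  shows "expect_on_inputs m \<phi> xs = expect_on_inputs m \<psi> xs"
  unfolding expect_on_inputs_def by (intro sum.cong refl) (simp add: assms)

lemma expect_on_inputs_add:
  "expect_on_inputs m (\<lambda>sl. \<phi> sl + \<psi> sl) xs = expect_on_inputs m \<phi> xs + expect_on_inputs m \<psi> xs"
  unfolding expect_on_inputs_def sum.distrib[symmetric]
  by (intro sum.cong refl) (simp add: distrib_left)

lemma expect_on_inputs_cmult: "expect_on_inputs m (\<lambda>sl. c * \<phi> sl) xs = c * expect_on_inputs m \<phi> xs"
  unfolding expect_on_inputs_def sum_distrib_left by (intro sum.cong refl) simp

lemma expect_on_inputs_diff:
  "expect_on_inputs m (\<lambda>sl. \<phi> sl - \<psi> sl) xs = expect_on_inputs m \<phi> xs - expect_on_inputs m \<psi> xs"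
  using expect_on_inputs_add[of m \<phi> "\<lambda>sl. - 1 * \<psi> sl"] expect_on_inputs_cmult[of m "- 1" \<psi>] by simp

lemma expect_on_inputs_snoc:
  "expect_on_inputs m \<phi> (xs @ [x]) = expect_on_inputs m (\<lambda>sl. of_bool (next_input m sl = x) *
     (\<Sum>s\<in>{0, 1}. PU \<eta> N x (battery sl) (q_after N xs) s * \<phi> (sl @ [s]))) xs"
  unfolding expect_on_inputs_def length_append_singleton sum_words_Suc
  by (intro sum.cong refl) (auto simp: inputs_snoc weight_snoc algebra_simps)

lemma input_law_snoc:
  "input_law m (xs @ [x]) = expect_on_inputs m (\<lambda>sl. of_bool (next_input m sl = x)) xs"
  using sum_PU by (simp add: input_law_def expect_on_inputs_snoc)

lemma charged_snoc:
  "charged m (xs @ [x]) = expect_on_inputs m (\<lambda>sl. of_bool (next_input m sl = x) *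
     PU \<eta> N x (battery sl) (q_after N xs) 1) xs"
  by (simp add: charged_def expect_on_inputs_snoc battery_def)

lemma input_law_Nil: "input_law m [] = 1"
  by (simp add: input_law_def expect_on_inputs_def inputs_def weight_def state_prob_def)

lemma charged_Nil: "charged m [] = 0"
  unfolding charged_def expect_on_inputs_def by (simp add: battery_def)

lemma input_law_nonneg: "0 \<le> input_law m xs"
  unfolding input_law_def expect_on_inputs_def by (intro sum_nonneg) (simp add: weight_nonneg)

lemma sequential_law_input_law:
  assumes m: "m \<in> {1..M}"
  shows "sequential_law {0, 1} n (input_law m)"
proof
  fix xs assume xs: "xs \<in> histories {0, 1 :: nat} n"
  have "input_law m xs = expect_on_inputs m
      (\<lambda>sl. of_bool (next_input m sl = 0) + of_bool (next_input m sl = 1)) xs"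
    unfolding input_law_def using next_input_binary[OF m] xs
    by (intro expect_on_inputs_cong) (fastforce simp: in_histories_iff)
  thus "input_law m xs = (\<Sum>x\<in>{0, 1}. input_law m (xs @ [x]))"
    by (simp add: expect_on_inputs_add input_law_snoc)
qed (simp_all add: input_law_Nil input_law_nonneg)

context
  fixes m :: nat and xs :: "nat list"
  assumes m: "m \<in> {1..M}" and xs: "length xs < n"
begin

lemma input_law_one_le_charged: "input_law m (xs @ [1]) \<le> charged m xs"
  unfolding input_law_snoc charged_def
proof (intro expect_on_inputs_mono)
  fix sl :: "nat list" assume "sl \<in> words {0, 1} (length xs)"
  thus "of_bool (next_input m sl = 1) \<le> (of_bool (battery sl = 1) :: real)"
    using next_input_le_battery[OF m _ xs] battery_binary by force
qed

lemma charged_one: "charged m (xs @ [1]) = \<eta> * input_law m (xs @ [1])"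
  unfolding charged_snoc input_law_snoc expect_on_inputs_cmult[symmetric]
proof (intro expect_on_inputs_cong)
  fix sl :: "nat list" assume "sl \<in> words {0, 1} (length xs)"
  thus "of_bool (next_input m sl = 1) * PU \<eta> N 1 (battery sl) (q_after N xs) 1
      = \<eta> * of_bool (next_input m sl = 1)"
    using next_input_le_battery[OF m _ xs] battery_binary by (force simp: PU_def behc_law_def)
qed

lemma charged_zero:
  "charged m (xs @ [0]) =
    idle_charge \<eta> N (q_after N xs) (input_law m (xs @ [0])) (charged m xs - input_law m (xs @ [1]))"
proof -
  let ?q = "q_after N xs"
  let ?idle_full = "\<lambda>sl. of_bool (battery sl = 1) - of_bool (next_input m sl = 1) :: real"
  let ?idle = "\<lambda>sl. of_bool (next_input m sl = 0) :: real"
  have "charged m (xs @ [0]) = expect_on_inputs m (\<lambda>sl. PU \<eta> N 0 1 ?q 1 * ?idle_full sl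
      + PU \<eta> N 0 0 ?q 1 * (?idle sl - ?idle_full sl)) xs"
    unfolding charged_snoc
  proof (intro expect_on_inputs_cong)
    fix sl :: "nat list" assume sl: "sl \<in> words {0, 1} (length xs)"
    hence "battery sl = 0 \<and> next_input m sl = 0
        \<or> battery sl = 1 \<and> (next_input m sl = 0 \<or> next_input m sl = 1)"
      using next_input_le_battery[OF m sl xs] battery_binary[OF sl] by auto
    thus "?idle sl * PU \<eta> N 0 (battery sl) ?q 1
        = PU \<eta> N 0 1 ?q 1 * ?idle_full sl + PU \<eta> N 0 0 ?q 1 * (?idle sl - ?idle_full sl)"
      by auto
  qed
  thus ?thesis
    unfolding expect_on_inputs_add expect_on_inputs_cmult expect_on_inputs_diff
    by (simp add: idle_charge_def input_law_snoc charged_def)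
qed

end

lemma sum_input_law:
  assumes "m \<in> {1..M}" "i \<le> n"
  shows "(\<Sum>xs\<in>words {0, 1} i. input_law m xs * \<phi> xs)
    = (\<Sum>sl\<in>words {0, 1} i. state_prob \<eta> N e i m sl * \<phi> (enc_x e m sl i))"
proof -
  have "(\<Sum>xs\<in>words {0, 1} i. input_law m xs * \<phi> xs) = (\<Sum>xs\<in>words {0, 1} i. \<Sum>sl\<in>words {0, 1} i.
      of_bool (inputs m sl = xs) * weight m sl * \<phi> (inputs m sl))"
    unfolding input_law_def expect_on_inputs_def sum_distrib_right
    by (intro sum.cong) (auto simp: length_words)
  also have "\<dots> = (\<Sum>sl\<in>words {0, 1} i. weight m sl * \<phi> (inputs m sl))"
    using inputs_in_words[OF assms(1) _ assms(2)]
    by (subst sum.swap) (simp add: of_bool_def sum.delta' flip: sum_distrib_right)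
  finally show ?thesis by (simp add: weight_def inputs_def length_words)
qed

end

section \<open>Starting with a fresh battery\<close>

text \<open>The weight of a full battery after the given inputs when these have law \<open>W\<close> and the battery
  starts with the law left behind by an input 1.\<close>
function charge :: "real \<Rightarrow> nat \<Rightarrow> (nat list \<Rightarrow> real) \<Rightarrow> nat list \<Rightarrow> real" where
  "charge \<eta> N W [] = \<eta>"
| "charge \<eta> N W (xs @ [x]) = (if x = 1 then \<eta> * W (xs @ [1])
     else idle_charge \<eta> N (q_after N xs) (W (xs @ [0])) (charge \<eta> N W xs - W (xs @ [1])))"
  by (metis prod_cases4 rev_exhaust) auto
termination by (relation "inv_image less_than (\<lambda>(\<eta>, N, W, xs). length xs)") auto

lemma (in boosted_code) charged_le_charge:
  assumes m: "m \<in> {1..M}"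
  shows "xs \<in> words {0, 1} i \<Longrightarrow> i \<le> n \<Longrightarrow> charged m xs \<le> charge \<eta> N (input_law m) xs"
proof (induction i arbitrary: xs)
  case 0
  thus ?case using eta by (simp add: charged_Nil)
next
  case (Suc i)
  from Suc.prems(1) obtain ys x where ys: "xs = ys @ [x]" "ys \<in> words {0, 1} i" "x \<in> {0, 1}"
    by (rule words_SucE)
  hence len: "length ys < n" using Suc.prems(2) by (simp add: length_words)
  show ?case
  proof (cases "x = 1")
    case True
    thus ?thesis using charged_one[OF m len] ys(1) by simp
  next
    case False
    thus ?thesis using charged_zero[OF m len] ys Suc eta(2) by (auto intro!: idle_charge_mono)
  qed
qed

section \<open>The block policy of a code\<close>

text \<open>The \<open>Idle\<close> symbols recharge the battery, \<open>Reset\<close> then resets the counter, and \<open>Send m xs t\<close>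
  follows the inputs \<open>xs\<close> sent for the message \<open>m\<close> in the current block and transmits a one iff
  \<open>t\<close> holds and the battery is full.\<close>
datatype 'm symbol = Idle nat | Reset | Send 'm "nat list" bool

fun symbol_input :: "'m symbol \<Rightarrow> nat \<Rightarrow> nat" where
  "symbol_input (Idle j) s = 0"
| "symbol_input Reset s = s"
| "symbol_input (Send m xs t) s = (if t then s else 0)"

fun symbol_phase :: "nat \<Rightarrow> 'm symbol \<Rightarrow> nat" where
  "symbol_phase n Reset = 0"
| "symbol_phase n (Send m xs t) = Suc (length xs)"
| "symbol_phase n (Idle j) = Suc (n + j)"

lemma sum_UNIV_bool: "(\<Sum>t\<in>UNIV. g t) = g False + g True"
  by (simp add: UNIV_bool)

lemma sum_if_eq_pair:
  fixes g :: "'a \<Rightarrow> 'b \<Rightarrow> 'c :: comm_monoid_add"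
  assumes "finite A" "finite B" "a \<in> A" "b \<in> B"
  shows "(\<Sum>a'\<in>A. \<Sum>b'\<in>B. if a' = a \<and> b' = b then g a' b' else 0) = g a b"
proof -
  have "(\<Sum>a'\<in>A. \<Sum>b'\<in>B. if a' = a \<and> b' = b then g a' b' else 0)
      = (\<Sum>a'\<in>A. if a' = a then \<Sum>b'\<in>B. if b' = b then g a' b' else 0 else 0)"
    by (intro sum.cong refl) auto
  thus ?thesis using assms by (simp add: sum.delta)
qed

locale block_policy =
  fixes \<eta> :: real and N n :: nat and I :: "'m set" and W :: "'m \<Rightarrow> nat list \<Rightarrow> real"
  assumes eta: "0 \<le> \<eta>" "\<eta> \<le> 1" and N_pos: "0 < N" and n_pos: "0 < n"
    and finite_messages: "finite I" and messages_nonempty: "I \<noteq> {}"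
    and W_sequential: "m \<in> I \<Longrightarrow> sequential_law {0, 1} n (W m)"
    and W_one_le_charge: "m \<in> I \<Longrightarrow> xs \<in> histories {0, 1} n \<Longrightarrow> W m (xs @ [1]) \<le> charge \<eta> N (W m) xs"
begin

lemma W_Nil: "m \<in> I \<Longrightarrow> W m [] = 1"
  by (rule sequential_law.law_Nil[OF W_sequential])

lemma W_nonneg: "m \<in> I \<Longrightarrow> 0 \<le> W m xs"
  by (rule sequential_law.law_nonneg[OF W_sequential])

lemma W_split: "m \<in> I \<Longrightarrow> xs \<in> histories {0, 1} n \<Longrightarrow> W m xs = W m (xs @ [0]) + W m (xs @ [1])"
  using sequential_law.law_split[OF W_sequential, of m xs] by simp

definition symbols :: "'m symbol set" where
  "symbols = Idle ` {..<N} \<union> {Reset} \<union>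
     (\<lambda>(m, xs, t). Send m xs t) ` (I \<times> histories {0, 1} n \<times> UNIV)"

definition strategy_law :: "'m \<Rightarrow> nat list \<Rightarrow> bool \<Rightarrow> real" where
  "strategy_law m xs t =
     (let p = W m (xs @ [1]) / charge \<eta> N (W m) xs in if t then p else 1 - p)"

fun policy :: "'m symbol \<Rightarrow> 'm symbol \<Rightarrow> nat \<Rightarrow> real" where
  "policy u' (Idle j) q = (if u' = (if Suc j < N then Idle (Suc j) else Reset) then 1 else 0)"
| "policy u' Reset q = (case u' of
       Send m xs t \<Rightarrow> if xs = [] then strategy_law m xs t / real (card I) else 0
     | _ \<Rightarrow> 0)"
| "policy u' (Send m xs t) q =
    (if Suc (length xs) < n then
       (case u' of
          Send m' xs' t' \<Rightarrow>
            if m' = m \<and> xs' = xs @ [of_bool (q = 0)] then strategy_law m' xs' t' else 0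
        | _ \<Rightarrow> 0)
     else if u' = Idle 0 then 1 else 0)"

lemma Idle_in_symbols [simp]: "Idle j \<in> symbols \<longleftrightarrow> j < N"
  by (auto simp: symbols_def)

lemma Reset_in_symbols [simp]: "Reset \<in> symbols"
  by (auto simp: symbols_def)

lemma Send_in_symbols [simp]: "Send m xs t \<in> symbols \<longleftrightarrow> m \<in> I \<and> xs \<in> histories {0, 1} n"
  by (auto simp: symbols_def image_iff)

lemma finite_symbols [simp]: "finite symbols"
  by (simp add: symbols_def finite_messages)

lemma sum_symbols:
  fixes g :: "'m symbol \<Rightarrow> real"
  shows "(\<Sum>u\<in>symbols. g u) = (\<Sum>j<N. g (Idle j)) + g Reset +
    (\<Sum>m\<in>I. \<Sum>xs\<in>histories {0, 1} n. \<Sum>t\<in>UNIV. g (Send m xs t))"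
proof -
  let ?sends = "I \<times> histories {0, 1} n \<times> UNIV"
  have "(\<Sum>u\<in>symbols. g u) = (\<Sum>u\<in>Idle ` {..<N}. g u) + g Reset +
      (\<Sum>u\<in>(\<lambda>(m, xs, t). Send m xs t) ` ?sends. g u)"
    unfolding symbols_def
    by (subst sum.union_disjoint, simp, simp add: finite_messages, force)+ simp
  moreover have "(\<Sum>u\<in>Idle ` {..<N}. g u) = (\<Sum>j<N. g (Idle j))"
    by (subst sum.reindex) (auto simp: inj_on_def)
  moreover have "(\<Sum>u\<in>(\<lambda>(m, xs, t). Send m xs t) ` ?sends. g u)
      = (\<Sum>(m, xs, t)\<in>?sends. g (Send m xs t))"
    by (subst sum.reindex) (auto simp: inj_on_def intro!: sum.cong)
  ultimately show ?thesis by (simp only: sum.cartesian_product)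
qed

lemma sum_strategy_law: "(\<Sum>t\<in>UNIV. strategy_law m xs t) = 1"
  by (simp add: sum_UNIV_bool strategy_law_def Let_def)

lemma strategy_law_nonneg:
  assumes "m \<in> I" "xs \<in> histories {0, 1} n"
  shows "0 \<le> strategy_law m xs t"
proof -
  note bounds = W_nonneg[OF assms(1), of "xs @ [1]"] W_one_le_charge[OF assms]
  hence "W m (xs @ [1]) / charge \<eta> N (W m) xs \<le> 1"
    by (cases "charge \<eta> N (W m) xs = 0") (auto simp: field_simps)
  thus ?thesis using bounds by (simp add: strategy_law_def Let_def)
qed

lemma strategy_law_mult_charge:
  assumes "m \<in> I" "xs \<in> histories {0, 1} n"
  shows "strategy_law m xs True * charge \<eta> N (W m) xs = W m (xs @ [1])"
  using W_nonneg[OF assms(1), of "xs @ [1]"] W_one_le_charge[OF assms]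
  by (cases "charge \<eta> N (W m) xs = 0") (auto simp: strategy_law_def)

lemma policy_nonneg: "u \<in> symbols \<Longrightarrow> u' \<in> symbols \<Longrightarrow> 0 \<le> policy u' u q"
  by (cases u; cases u') (auto intro!: strategy_law_nonneg divide_nonneg_nonneg)

lemma sum_policy_Reset: "(\<Sum>u'\<in>symbols. policy u' Reset q) = 1"
proof -
  have sends: "(\<Sum>t\<in>UNIV. policy (Send m xs t) Reset q) = (if xs = [] then 1 / real (card I) else 0)"
    for m xs by (simp add: sum_strategy_law flip: sum_divide_distrib)
  show ?thesis
    unfolding sum_symbols sends using finite_messages messages_nonempty n_pos
    by (simp add: sum.delta)
qed

lemma sum_policy_Send:
  assumes "m \<in> I" "xs \<in> histories {0, 1} n"
  shows "(\<Sum>u'\<in>symbols. policy u' (Send m xs t) q) = 1"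
proof (cases "Suc (length xs) < n")
  case True
  let ?ys = "xs @ [of_bool (q = 0)]"
  have ys: "?ys \<in> histories {0, 1} n" using assms True by (auto simp: in_histories_iff)
  have sends: "(\<Sum>t'\<in>UNIV. policy (Send m' xs' t') (Send m xs t) q) =
      (if m' = m \<and> xs' = ?ys then 1 else 0)" for m' xs'
    using True sum_strategy_law by (cases "m' = m \<and> xs' = ?ys") auto
  have "(\<Sum>u'\<in>symbols. policy u' (Send m xs t) q)
      = (\<Sum>m'\<in>I. \<Sum>xs'\<in>histories {0, 1} n. if m' = m \<and> xs' = ?ys then 1 else 0)"
    unfolding sum_symbols sends using True by simp
  also have "\<dots> = 1" by (rule sum_if_eq_pair) (use assms ys finite_messages in auto)
  finally show ?thesis .
next
  case False
  thus ?thesis using N_pos by (simp add: sum.delta)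
qed

sublocale strategy_policy \<eta> N symbols symbol_input policy
proof
  show "symbol_input u s \<in> {0, 1}" if "s \<in> {0, 1}" for u :: "'m symbol" and s
    using that by (cases u) auto
  show "symbol_input u 0 = 0" for u :: "'m symbol" by (cases u) auto
  show "(\<Sum>u'\<in>symbols. policy u' u q) = 1" if "u \<in> symbols" for u q
  proof (cases u)
    case (Idle j)
    thus ?thesis using that by (simp add: sum.delta)
  next
    case Reset
    show ?thesis unfolding Reset by (rule sum_policy_Reset)
  next
    case (Send m xs t)
    hence "m \<in> I" "xs \<in> histories {0, 1} n" using that by auto
    thus ?thesis unfolding Send by (rule sum_policy_Send)
  qed
  show "symbols \<noteq> {}" using Reset_in_symbols by blast
qed (simp_all add: eta policy_nonneg)

lemma symbol_phase_less: "u \<in> symbols \<Longrightarrow> symbol_phase n u < Suc (n + N)"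
  by (cases u) (auto simp: in_histories_iff)

lemma symbol_phase_policy:
  assumes "u \<in> symbols" "u' \<in> symbols" "policy u' u q \<noteq> 0"
  shows "symbol_phase n u' = Suc (symbol_phase n u) mod Suc (n + N)"
  using assms n_pos by (cases u; cases u') (auto simp: in_histories_iff mod_Suc split: if_splits)

definition phase :: "nat \<times> 'm symbol \<times> nat \<Rightarrow> nat" where
  "phase = (\<lambda>(s, u, q). symbol_phase n u)"

text \<open>In a regular state the counter has registered the zeros sent so far, and the battery is full
  once they are \<open>N\<close>.\<close>
definition regular :: "nat \<times> 'm symbol \<times> nat \<Rightarrow> bool" where
  "regular = (\<lambda>(s, u, q). case u of Idle j \<Rightarrow> j < q \<and> (q = N \<longrightarrow> s = 1) | _ \<Rightarrow> True)"

definition fresh :: "nat \<times> 'm symbol \<times> nat \<Rightarrow> real" where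
  "fresh = (\<lambda>(s, u, q). if q = 0 then if s = 1 then \<eta> else 1 - \<eta> else 0)"

lemma regular_step:
  assumes states: "(s, u, q) \<in> states" "(s', u', q') \<in> states"
    and step: "kernel (s', u', q') (s, u, q) \<noteq> 0" and regular: "regular (s, u, q)"
  shows "regular (s', u', q')"
proof (cases u')
  case (Idle j)
  have q: "q' = gU N q 0" and policy: "policy (Idle j) u q \<noteq> 0" and PU: "PU \<eta> N 0 s q s' \<noteq> 0"
    using step Idle by (auto split: if_splits)
  have "j \<le> q"
    using policy regular by (cases u) (auto simp: regular_def split: if_splits)
  moreover have "s' = 1" if "q' = N"
    using PU q that N_pos states(1)
    by (auto simp: states_def PU_def gU_def min_def split: if_splits)
  moreover have "j < N" using states(2) Idle by (simp add: states_def)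
  ultimately show ?thesis using Idle q by (auto simp: regular_def gU_def)
qed (auto simp: regular_def)

lemma kernel_renewal:
  assumes states: "(s, u, q) \<in> states" "(s', u', q') \<in> states"
    and phases: "symbol_phase n u = n + N" "symbol_phase n u' = 0" and regular: "regular (s, u, q)"
  shows "kernel (s', u', q') (s, u, q) = fresh (s', u', q')"
proof -
  have u: "u = Idle (N - 1)"
    using states(1) phases(1) N_pos by (cases u) (auto simp: states_def in_histories_iff)
  hence "q = N" "s = 1" using regular states(1) by (auto simp: regular_def states_def)
  moreover have "u' = Reset" using phases(2) by (cases u') auto
  ultimately show ?thesis
    using u states(2) N_pos by (auto simp: states_def fresh_def gU_def PU_def behc_law_def)
qed

lemma sum_fresh: "(\<Sum>w | w \<in> states \<and> phase w = 0. fresh w) = 1"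
proof -
  have slices: "(\<Sum>s\<in>{0, 1}. \<Sum>q\<in>{0..N}. if phase (s, u, q) = 0 then fresh (s, u, q) else 0)
      = (if symbol_phase n u = 0 then 1 else 0)" for u
    by (simp add: phase_def fresh_def sum.delta)
  have "(\<Sum>w | w \<in> states \<and> phase w = 0. fresh w) = (\<Sum>w\<in>states. if phase w = 0 then fresh w else 0)"
    by (rule sum.inter_filter) (rule finite_states)
  also have "\<dots> = (\<Sum>u\<in>symbols. if symbol_phase n u = 0 then 1 else 0)"
    unfolding sum_states by (subst sum.swap) (simp only: slices)
  also have "\<dots> = 1" by (simp add: sum_symbols)
  finally show ?thesis .
qed

sublocale cyclic_chain states kernel phase "Suc (n + N)" regular fresh
proof
  show "(\<Sum>w | w \<in> states \<and> phase w = 0. fresh w) = 1" by (rule sum_fresh)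
  fix w assume "w \<in> states"
  moreover obtain s u q where w: "w = (s, u, q)" by (cases w)
  ultimately show "phase w < Suc (n + N)" "phase w = 0 \<Longrightarrow> regular w" "0 \<le> fresh w"
    using eta by (auto simp: states_def phase_def regular_def fresh_def symbol_phase_less
        split: symbol.splits)
  fix w' assume states: "w \<in> states" "w' \<in> states"
  obtain s' u' q' where w': "w' = (s', u', q')" by (cases w')
  show "phase w' = Suc (phase w) mod Suc (n + N)" if "kernel w' w \<noteq> 0"
    using that states unfolding w w'
    by (auto simp: phase_def states_def split: if_splits intro!: symbol_phase_policy)
  show "regular w'" if "kernel w' w \<noteq> 0" "regular w"
    using that states unfolding w w' by (metis regular_step)
  show "kernel w' w = fresh w'" if "Suc (phase w) = Suc (n + N)" "regular w" "phase w' = 0"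
    using that states kernel_renewal unfolding w w' phase_def by simp
qed simp

sublocale stationary_policy \<eta> N symbols symbol_input policy stationary_law
  by unfold_locales (rule stationary_on_stationary_law, rule stationary_law_unique)

lemma stationary_law_Reset:
  assumes "s \<in> {0, 1}" "q \<le> N"
  shows "stationary_law (s, Reset, q) = fresh (s, Reset, q) / real (Suc (n + N))"
  using assms by (intro stationary_law_renewal) (auto simp: states_def phase_def)

lemma selected_Reset_empty:
  assumes "q \<le> N"
  shows "selected Reset 0 q = 0"
  unfolding selected_def
proof (intro sum.neutral ballI)
  fix u assume u: "u \<in> symbols"
  show "stationary_law (0, u, q) * policy Reset u q = 0"
  proof (cases "stationary_law (0, u, q) = 0")
    case False
    hence "regular (0, u, q)"
      using u assms by (intro stationary_law_regular) (simp_all add: states_def)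
    hence "policy Reset u q = 0" using u assms by (cases u) (auto simp: regular_def)
    thus ?thesis by simp
  qed simp
qed

definition battery_law :: "'m \<Rightarrow> nat list \<Rightarrow> nat \<Rightarrow> real" where
  "battery_law m xs s =
     (if s = 1 then charge \<eta> N (W m) xs else W m xs - charge \<eta> N (W m) xs)"

lemma battery_step:
  assumes m: "m \<in> I" and xs: "xs \<in> histories {0, 1} n" and x: "x \<in> {0, 1}" and s': "s' \<in> {0, 1}"
  shows "(\<Sum>t\<in>UNIV. \<Sum>s\<in>{0, 1}. if x = (if t then s else 0)
      then strategy_law m xs t * battery_law m xs s * PU \<eta> N x s (q_after N xs) s' else 0)
    = battery_law m (xs @ [x]) s'"
proof -
  let ?q = "q_after N xs" and ?V = "charge \<eta> N (W m) xs" and ?p = "strategy_law m xs True"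
  have False_law: "strategy_law m xs False = 1 - ?p" by (simp add: strategy_law_def Let_def)
  have full: "?p * ?V = W m (xs @ [1])" by (rule strategy_law_mult_charge[OF m xs])
  show ?thesis
  proof (cases "x = 1")
    case True
    have "PU \<eta> N 1 1 ?q s' = (if s' = 1 then \<eta> else 1 - \<eta>)"
      using s' by (auto simp: PU_def behc_law_def)
    thus ?thesis
      using True full by (auto simp: sum_UNIV_bool battery_law_def algebra_simps)
  next
    case False
    hence x0: "x = 0" using x by simp
    have "(\<Sum>t\<in>UNIV. \<Sum>s\<in>{0, 1}. if x = (if t then s else 0)
        then strategy_law m xs t * battery_law m xs s * PU \<eta> N x s ?q s' else 0)
      = (W m xs - ?V) * PU \<eta> N 0 0 ?q s' + (?V - ?p * ?V) * PU \<eta> N 0 1 ?q s'"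
      by (simp add: x0 sum_UNIV_bool False_law battery_law_def algebra_simps)
    also have "\<dots> = battery_law m (xs @ [0]) s'"
    proof -
      have "PU \<eta> N 0 s ?q s' = (if s' = 1 then PU \<eta> N 0 s ?q 1 else 1 - PU \<eta> N 0 s ?q 1)" for s
        using s' sum_PU[of \<eta> N 0 s ?q] by auto
      thus ?thesis unfolding full W_split[OF m xs]
        by (simp add: battery_law_def idle_charge_def algebra_simps)
    qed
    finally show ?thesis by (simp add: x0)
  qed
qed

lemma strategy_input_law:
  assumes "m \<in> I" "xs \<in> histories {0, 1} n" "x \<in> {0, 1}"
  shows "(\<Sum>t\<in>UNIV. \<Sum>s\<in>{0, 1}. if x = (if t then s else 0)
      then strategy_law m xs t * battery_law m xs s else 0) = W m (xs @ [x])"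
proof -
  have "W m (xs @ [x]) = (\<Sum>s'\<in>{0, 1}. battery_law m (xs @ [x]) s')"
    by (simp add: battery_law_def)
  also have "\<dots> = (\<Sum>s'\<in>{0, 1}. \<Sum>t\<in>UNIV. \<Sum>s\<in>{0, 1}. if x = (if t then s else 0)
      then strategy_law m xs t * battery_law m xs s * PU \<eta> N x s (q_after N xs) s' else 0)"
    by (intro sum.cong refl battery_step[OF assms, symmetric])
  also have "\<dots> = (\<Sum>t\<in>UNIV. \<Sum>s\<in>{0, 1}. \<Sum>s'\<in>{0, 1}. if x = (if t then s else 0)
      then strategy_law m xs t * battery_law m xs s * PU \<eta> N x s (q_after N xs) s' else 0)"
    by (subst sum.swap) (intro sum.cong[OF refl] sum.swap)
  also have "\<dots> = (\<Sum>t\<in>UNIV. \<Sum>s\<in>{0, 1}. if x = (if t then s else 0)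
      then strategy_law m xs t * battery_law m xs s else 0)"
  proof (intro sum.cong refl)
    fix t s
    show "(\<Sum>s'\<in>{0, 1}. if x = (if t then s else 0)
        then strategy_law m xs t * battery_law m xs s * PU \<eta> N x s (q_after N xs) s' else 0)
      = (if x = (if t then s else 0) then strategy_law m xs t * battery_law m xs s else 0)"
      using sum_PU[of \<eta> N x s "q_after N xs"] by (auto simp flip: distrib_left)
  qed
  finally show ?thesis ..
qed

definition block_weight :: real where
  "block_weight = 1 / (real (card I) * real (Suc (n + N)))"

lemma policy_Send_Idle: "policy (Send m xs t) (Idle j) q = 0"
  by simp

lemma policy_Send_Nil_Send: "policy (Send m [] t) (Send m' xs' t') q = 0"
  by auto

lemma selected_Send_Nil:
  assumes "m \<in> I"
  shows "selected (Send m [] t) s q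
    = stationary_law (s, Reset, q) * (strategy_law m [] t / real (card I))"
  unfolding selected_def sum_symbols policy_Send_Idle policy_Send_Nil_Send by simp

lemma selected_Send_snoc:
  assumes "m \<in> I" "xs \<in> histories {0, 1} n" "Suc (length xs) < n"
  shows "selected (Send m (xs @ [x]) t) s q = (if x = of_bool (q = 0)
    then (\<Sum>t'\<in>UNIV. stationary_law (s, Send m xs t', q)) * strategy_law m (xs @ [x]) t else 0)"
proof -
  let ?g = "\<lambda>m' xs'. if x = of_bool (q = 0)
    then (\<Sum>t'\<in>UNIV. stationary_law (s, Send m' xs' t', q)) * strategy_law m (xs @ [x]) t else 0"
  have sends: "(\<Sum>t'\<in>UNIV. stationary_law (s, Send m' xs' t', q)
      * policy (Send m (xs @ [x]) t) (Send m' xs' t') q)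
    = (if m' = m \<and> xs' = xs then ?g m' xs' else 0)" for m' xs'
    using assms(3) by (auto simp: sum_distrib_right)
  have "selected (Send m (xs @ [x]) t) s q =
     (\<Sum>m'\<in>I. \<Sum>xs'\<in>histories {0, 1} n. if m' = m \<and> xs' = xs then ?g m' xs' else 0)"
    unfolding selected_def sum_symbols sends policy_Send_Idle by simp
  also have "\<dots> = ?g m xs" by (rule sum_if_eq_pair) (use assms finite_messages in auto)
  finally show ?thesis .
qed

text \<open>Because \<open>N > 0\<close>, the counter is zero exactly after an input 1, so it reveals the last input.\<close>
lemma gU_eq_iff:
  assumes "x \<in> {0, 1}"
  shows "q' = gU N q x \<longleftrightarrow> x = of_bool (q' = 0) \<and> q' = gU N q (of_bool (q' = 0))"
  using assms N_pos by (auto simp: gU_def)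

lemma stationary_law_Send:
  assumes m: "m \<in> I" and xs: "xs \<in> histories {0, 1} n" and s': "s' \<in> {0, 1}" and q': "q' \<le> N"
    and selected: "\<And>t s q. s \<in> {0, 1} \<Longrightarrow> q \<le> N \<Longrightarrow> selected (Send m xs t) s q =
      (if q = q_after N xs then block_weight * (strategy_law m xs t * battery_law m xs s) else 0)"
    and x: "x = of_bool (q' = 0)"
  shows "(\<Sum>t\<in>UNIV. stationary_law (s', Send m xs t, q')) =
    (if q' = q_after N (xs @ [x]) then block_weight * battery_law m (xs @ [x]) s' else 0)"
proof -
  let ?q = "q_after N xs"
  let ?step = "\<lambda>t s. if x = (if t then s else 0)
    then strategy_law m xs t * battery_law m xs s * PU \<eta> N x s ?q s' else 0"
  have "stationary_law (s', Send m xs t, q')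
      = (\<Sum>s\<in>{0, 1}. if q' = gU N ?q x then block_weight * ?step t s else 0)" for t
  proof -
    have "stationary_law (s', Send m xs t, q') = (\<Sum>s\<in>{0, 1}. \<Sum>q\<in>{0..N}.
        if q' = gU N q (if t then s else 0)
        then selected (Send m xs t) s q * PU \<eta> N (if t then s else 0) s q s' else 0)"
      by (rule stationary_step[of "Send m xs t" s' q', unfolded symbol_input.simps])
        (use m xs s' q' in simp_all)
    also have "\<dots> = (\<Sum>s\<in>{0, 1}. \<Sum>q\<in>{0..N}. if q = ?q
        then if q' = gU N ?q x then block_weight * ?step t s else 0 else 0)"
    proof (intro sum.cong refl)
      fix s q assume "s \<in> {0, 1 :: nat}" "q \<in> {0..N}"
      moreover from this have "(if t then s else 0) \<in> {0, 1}" by simp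
      ultimately show "(if q' = gU N q (if t then s else 0)
          then selected (Send m xs t) s q * PU \<eta> N (if t then s else 0) s q s' else 0)
        = (if q = ?q then if q' = gU N ?q x then block_weight * ?step t s else 0 else 0)"
        using gU_eq_iff[of "if t then s else 0" q' q] x by (auto simp: selected)
    qed
    finally show ?thesis using q_after_le[of N xs] by (simp add: sum.delta')
  qed
  hence "(\<Sum>t\<in>UNIV. stationary_law (s', Send m xs t, q'))
      = (if q' = gU N ?q x then block_weight * (\<Sum>t\<in>UNIV. \<Sum>s\<in>{0, 1}. ?step t s) else 0)"
    by (simp only: sum_distrib_left) simp
  also have "(\<Sum>t\<in>UNIV. \<Sum>s\<in>{0, 1}. ?step t s) = battery_law m (xs @ [x]) s'"
    using m xs s' x by (intro battery_step) auto
  finally show ?thesis by (simp add: q_after_snoc)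
qed

lemma selected_Send:
  assumes "m \<in> I" "xs \<in> histories {0, 1} n" "s \<in> {0, 1}" "q \<le> N"
  shows "selected (Send m xs t) s q =
    (if q = q_after N xs then block_weight * (strategy_law m xs t * battery_law m xs s) else 0)"
  using assms(2-)
proof (induction xs arbitrary: t s q rule: rev_induct)
  case Nil
  thus ?case
    unfolding selected_Send_Nil[OF assms(1)] stationary_law_Reset[OF Nil(2,3)]
    by (simp add: fresh_def block_weight_def battery_law_def W_Nil assms(1) mult_ac)
next
  case (snoc x xs)
  hence xs: "xs \<in> histories {0, 1} n" "Suc (length xs) < n" and x: "x \<in> {0, 1}"
    by (auto simp: in_histories_iff)
  show ?case
  proof (cases "x = of_bool (q = 0)")
    case True
    thus ?thesis
      unfolding selected_Send_snoc[OF assms(1) xs]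
      using stationary_law_Send[OF assms(1) xs(1) snoc.prems(2,3) snoc.IH[OF xs(1)] True] by simp
  next
    case False
    hence "q \<noteq> q_after N (xs @ [x])" using gU_eq_iff[OF x] by (auto simp: q_after_snoc)
    thus ?thesis using False by (simp add: selected_Send_snoc[OF assms(1) xs])
  qed
qed

lemma emitted_Send:
  assumes "m \<in> I" "xs \<in> histories {0, 1} n" "x \<in> {0, 1}" "q \<le> N"
  shows "(\<Sum>t\<in>UNIV. emitted (Send m xs t) x q) =
    (if q = q_after N xs then block_weight * W m (xs @ [x]) else 0)"
proof -
  have "(\<Sum>t\<in>UNIV. emitted (Send m xs t) x q) = (\<Sum>t\<in>UNIV. \<Sum>s\<in>{0, 1}. if q = q_after N xs
      then block_weight *
        (if x = (if t then s else 0) then strategy_law m xs t * battery_law m xs s else 0)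
      else 0)"
    unfolding emitted_def by (intro sum.cong refl) (use assms in \<open>simp add: selected_Send\<close>)
  thus ?thesis
    unfolding strategy_input_law[OF assms(1-3), symmetric] sum_distrib_left by simp
qed

fun test_law :: "'m symbol \<Rightarrow> nat \<Rightarrow> real" where
  "test_law (Idle j) x = (if x = 0 then 1 else 0)"
| "test_law Reset x = (if x = 1 then 1 else 0)"
| "test_law (Send m xs t) x = W m (xs @ [x]) / W m xs"

lemma emitted_Idle: "x \<in> {0, 1} \<Longrightarrow> emitted (Idle j) x q \<noteq> 0 \<Longrightarrow> x = 0"
  by (auto simp: emitted_def)

lemma emitted_Reset: "x \<in> {0, 1} \<Longrightarrow> q \<le> N \<Longrightarrow> emitted Reset x q \<noteq> 0 \<Longrightarrow> x = 1"
  by (auto simp: emitted_def selected_Reset_empty)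

lemma test_law_nonneg: "u \<in> symbols \<Longrightarrow> 0 \<le> test_law u x"
  by (cases u) (auto simp: W_nonneg)

lemma sum_test_law_le_1:
  assumes "u \<in> symbols"
  shows "(\<Sum>x\<in>{0, 1}. test_law u x) \<le> 1"
proof (cases u)
  case (Send m xs t)
  hence "W m xs = W m (xs @ [0]) + W m (xs @ [1])" using assms by (intro W_split) auto
  thus ?thesis using Send by (cases "W m xs = 0") (simp_all flip: add_divide_distrib)
qed simp_all

lemma test_law_pos:
  assumes u: "u \<in> symbols" and x: "x \<in> {0, 1}" and q: "q \<le> N" and pos: "0 < emitted u x q"
  shows "0 < test_law u x"
proof (cases u)
  case (Idle j)
  thus ?thesis using emitted_Idle[OF x, of j q] pos by simp
next
  case Reset
  thus ?thesis using emitted_Reset[OF x q] pos by simp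
next
  case (Send m xs t)
  hence m: "m \<in> I" and xs: "xs \<in> histories {0, 1} n" using u by auto
  have "0 < (\<Sum>t\<in>UNIV. emitted (Send m xs t) x q)"
    using pos m xs q unfolding Send by (intro sum_pos2[of UNIV t] emitted_nonneg) auto
  hence "W m (xs @ [x]) \<noteq> 0" by (auto simp: emitted_Send[OF m xs x q] split: if_splits)
  hence "0 < W m (xs @ [x])" using W_nonneg[OF m, of "xs @ [x]"] by linarith
  moreover have "W m (xs @ [x]) \<le> W m xs"
    by (rule sequential_law.law_snoc_le[OF W_sequential[OF m] xs x])
  ultimately show ?thesis using Send by simp
qed

lemma output_law_q_after_pos:
  assumes "m \<in> I" "xs \<in> histories {0, 1} n" "x \<in> {0, 1}" "0 < W m (xs @ [x])"
  shows "0 < output_law (q_after N xs) x"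
proof -
  have "0 < block_weight"
    using finite_messages messages_nonempty by (simp add: block_weight_def card_gt_0_iff)
  hence "0 < (\<Sum>t\<in>UNIV. emitted (Send m xs t) x (q_after N xs))"
    using assms by (simp add: emitted_Send q_after_le)
  then obtain t where "0 < emitted (Send m xs t) x (q_after N xs)"
    by (metis not_less sum_nonpos)
  thus ?thesis using assms by (intro output_law_pos[of "Send m xs t"]) (auto simp: q_after_le)
qed

lemma information_gain_Send:
  assumes "m \<in> I" "xs \<in> histories {0, 1} n"
  shows "(\<Sum>t\<in>UNIV. information_gain test_law (Send m xs t))
    = block_weight * step_divergence {0, 1} (W m) (\<lambda>xs. output_law (q_after N xs)) xs"
proof -
  let ?g = "\<lambda>x q. log 2 (W m (xs @ [x]) / W m xs / output_law q x)"
  have "(\<Sum>t\<in>UNIV. information_gain test_law (Send m xs t))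
      = (\<Sum>x\<in>{0, 1}. \<Sum>q\<in>{0..N}. (\<Sum>t\<in>UNIV. emitted (Send m xs t) x q) * ?g x q)"
    unfolding information_gain_def test_law.simps sum_distrib_right
    by (subst sum.swap) (intro sum.cong[OF refl] sum.swap)
  also have "\<dots> = (\<Sum>x\<in>{0, 1}. \<Sum>q\<in>{0..N}.
      if q = q_after N xs then block_weight * (W m (xs @ [x]) * ?g x q) else 0)"
    by (intro sum.cong refl) (use assms in \<open>auto simp: emitted_Send\<close>)
  also have "\<dots> = (\<Sum>x\<in>{0, 1}. block_weight * (W m (xs @ [x]) * ?g x (q_after N xs)))"
    using q_after_le[of N xs] by (simp add: sum.delta)
  finally show ?thesis by (simp only: step_divergence_def sum_distrib_left)
qed

lemma step_divergence_le_upper_bound: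
  "ereal (block_weight * (\<Sum>m\<in>I. \<Sum>xs\<in>histories {0, 1} n.
      step_divergence {0, 1} (W m) (\<lambda>xs. output_law (q_after N xs)) xs)) \<le> upper_bound \<eta> N"
proof -
  have "0 \<le> information_gain test_law (Idle j)" if "j < N" for j
    using that emitted_Idle by (intro information_gain_nonneg) auto
  moreover have "0 \<le> information_gain test_law Reset"
    using emitted_Reset by (intro information_gain_nonneg) auto
  ultimately have "(\<Sum>m\<in>I. \<Sum>xs\<in>histories {0, 1} n. \<Sum>t\<in>UNIV. information_gain test_law (Send m xs t))
      \<le> (\<Sum>u\<in>symbols. information_gain test_law u)"
    unfolding sum_symbols by (auto intro!: add_nonneg_nonneg sum_nonneg)
  hence "block_weight * (\<Sum>m\<in>I. \<Sum>xs\<in>histories {0, 1} n.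
      step_divergence {0, 1} (W m) (\<lambda>xs. output_law (q_after N xs)) xs)
      \<le> (\<Sum>u\<in>symbols. information_gain test_law u)"
    by (simp add: information_gain_Send sum_distrib_left)
  moreover have "ereal (\<Sum>u\<in>symbols. information_gain test_law u) \<le> upper_bound \<eta> N"
    by (intro sum_information_gain_le_upper_bound test_law_nonneg sum_test_law_le_1 test_law_pos)
  ultimately show ?thesis by (meson ereal_less_eq(3) order_trans)
qed

lemma fano_rate_le_upper_bound:
  "ereal (((1 - decoding_error I (words {0, 1} n) W d) * log 2 (real (card I)) - 1)
    / real (Suc (n + N))) \<le> upper_bound \<eta> N"
  (is "ereal (?rate / _) \<le> _")
proof -
  let ?r = "\<lambda>xs. output_law (q_after N xs)"
  have "?rate
      \<le> (\<Sum>m\<in>I. \<Sum>xs\<in>histories {0, 1} n. step_divergence {0, 1} (W m) ?r xs) / real (card I)"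
    using finite_messages messages_nonempty W_sequential
  proof (rule fano_sequential)
    show "0 \<le> ?r xs x" if "x \<in> {0, 1}" for xs x
      using q_after_le that by (rule output_law_nonneg)
    show "(\<Sum>x\<in>{0, 1}. ?r xs x) \<le> 1" for xs
      by (rule sum_output_law_le_1)
    show "0 < ?r xs x" if "m \<in> I" "xs \<in> histories {0, 1} n" "x \<in> {0, 1}" "0 < W m (xs @ [x])"
      for m xs x
      using that by (rule output_law_q_after_pos)
  qed
  hence "?rate / real (Suc (n + N))
      \<le> block_weight * (\<Sum>m\<in>I. \<Sum>xs\<in>histories {0, 1} n. step_divergence {0, 1} (W m) ?r xs)"
    by (simp add: block_weight_def divide_right_mono del: of_nat_Suc flip: divide_divide_eq_left)
  thus ?thesis using step_divergence_le_upper_bound by (meson ereal_less_eq(3) order_trans)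
qed

end

section \<open>A policy without counter\<close>

text \<open>With \<open>N = 0\<close> every idle step charges the battery. Hence if the strategies \<open>x = 0\<close> and \<open>x = s\<close>
  alternate, the auxiliary symbol determines the input, which is a fair bit.\<close>
locale alternating_policy =
  fixes \<eta> :: real
  assumes eta: "0 \<le> \<eta>" "\<eta> \<le> 1"
begin

definition input :: "bool \<Rightarrow> nat \<Rightarrow> nat" where
  "input u s = (if u then s else 0)"

definition policy :: "bool \<Rightarrow> bool \<Rightarrow> nat \<Rightarrow> real" where
  "policy u' u q = of_bool (u' \<noteq> u)"

sublocale strategy_policy \<eta> 0 UNIV input policy
  by unfold_locales (auto simp: eta input_def policy_def UNIV_bool)

definition phase :: "nat \<times> bool \<times> nat \<Rightarrow> nat" where
  "phase = (\<lambda>(s, u, q). of_bool (\<not> u))"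

definition regular :: "nat \<times> bool \<times> nat \<Rightarrow> bool" where
  "regular = (\<lambda>(s, u, q). u \<or> s = 1)"

definition fresh :: "nat \<times> bool \<times> nat \<Rightarrow> real" where
  "fresh = (\<lambda>(s, u, q). if s = 1 then \<eta> else 1 - \<eta>)"

sublocale cyclic_chain states kernel phase 2 regular fresh
proof
  have "{w \<in> states. phase w = 0} = {(0, True, 0), (1, True, 0)}"
    by (auto simp: states_def phase_def)
  thus "(\<Sum>w | w \<in> states \<and> phase w = 0. fresh w) = 1" by (simp add: fresh_def)
qed (use eta in \<open>auto simp: states_def phase_def regular_def fresh_def input_def policy_def gU_def
  PU_def behc_law_def split: if_splits\<close>)

sublocale stationary_policy \<eta> 0 UNIV input policy stationary_law
  by unfold_locales (rule stationary_on_stationary_law, rule stationary_law_unique)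

lemma stationary_law_values:
  "stationary_law (0, True, 0) + stationary_law (1, True, 0) = 1 / 2"
  "stationary_law (0, False, 0) = 0" "stationary_law (1, False, 0) = 1 / 2"
proof -
  have "stationary_law (s, True, 0) = fresh (s, True, 0) / 2" if "s \<in> {0, 1}" for s
    using that stationary_law_renewal[of "(s, True, 0)"] by (simp add: states_def phase_def)
  thus active: "stationary_law (0, True, 0) + stationary_law (1, True, 0) = 1 / 2"
    by (simp add: fresh_def flip: add_divide_distrib)
  show empty: "stationary_law (0, False, 0) = 0"
    using stationary_law_regular[of "(0, False, 0)"] by (auto simp: states_def regular_def)
  have "(\<Sum>w\<in>states. stationary_law w) = 1" by (rule stationary_onD(3)[OF stationary])
  thus "stationary_law (1, False, 0) = 1 / 2"
    using active empty by (simp add: sum_states sum_UNIV_bool)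
qed

lemma emitted_eq: "x \<in> {0, 1} \<Longrightarrow> emitted u x 0 = (if x = of_bool u then 1 / 2 else 0)"
  using stationary_law_values
  by (cases u) (auto simp: emitted_def selected_def input_def policy_def sum_UNIV_bool)

lemma output_law_eq:
  assumes "x \<in> {0, 1}"
  shows "output_law 0 x = 1 / 2"
proof -
  have "(\<Sum>uu\<in>UNIV \<times> UNIV. joint stationary_law uu x 0) = 1 / 2" if "x \<in> {0, 1}" for x
    using sum_joint_pairs[of x 0 "\<lambda>_. 1"] that by (auto simp: emitted_eq sum_UNIV_bool)
  from this[of 0] this[of 1] this[OF assms] show ?thesis
    by (simp add: output_law_def cond_marginal_def sum.distrib)
qed

lemma one_le_upper_bound: "1 \<le> upper_bound \<eta> 0"
proof -
  let ?\<rho> = "\<lambda>u x. if x = of_bool u then 1 else 0 :: real"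
  have "ereal (\<Sum>u\<in>UNIV. information_gain ?\<rho> u) \<le> upper_bound \<eta> 0"
    by (rule sum_information_gain_le_upper_bound) (auto simp: emitted_eq split: if_splits)
  moreover have "information_gain ?\<rho> u = 1 / 2" for u
    by (cases u) (simp_all add: information_gain_def emitted_eq output_law_eq)
  ultimately show ?thesis by (simp add: sum_UNIV_bool one_ereal_def)
qed

end

section \<open>The capacity bound\<close>

lemma num_msgs_ge: "2 powr (real n * R) \<le> real (num_msgs R n)"
  unfolding num_msgs_def by linarith

lemma num_msgs_pos: "0 < num_msgs R n"
  unfolding num_msgs_def by simp

context boosted_code
begin

lemma err_prob_eq_decoding_error:
  "err_prob \<eta> N e d n M = decoding_error {1..M} (words {0, 1} n) input_law d"
proof -
  have "(\<Sum>m\<in>{1..M}. \<Sum>xs\<in>words {0, 1} n. input_law m xs * (if d xs \<noteq> m then 1 else 0))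
      = (\<Sum>m\<in>{1..M}. \<Sum>sl\<in>words {0, 1} n.
          state_prob \<eta> N e n m sl * (if d (enc_x e m sl n) \<noteq> m then 1 else 0))"
    by (intro sum.cong refl sum_input_law) auto
  thus ?thesis by (simp add: err_prob_def decoding_error_def state_seqs_eq_words)
qed

lemma err_prob_le_1: "err_prob \<eta> N e d n M \<le> 1"
  unfolding err_prob_eq_decoding_error
  by (intro decoding_error_le_1 input_law_nonneg
      sequential_law.sum_law[OF sequential_law_input_law order_refl])

lemma fano_rate_le_length:
  assumes "0 < M"
  shows "(1 - err_prob \<eta> N e d n M) * log 2 (real M) - 1 \<le> real n"
proof -
  let ?D = "\<lambda>m xs. step_divergence {0, 1} (input_law m) (\<lambda>_ _. 1 / 2) xs"
  have "(1 - decoding_error {1..M} (words {0, 1} n) input_law d) * log 2 (real (card {1..M})) - 1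
      \<le> (\<Sum>m\<in>{1..M}. \<Sum>xs\<in>histories {0, 1} n. ?D m xs) / real (card {1..M})"
    by (rule fano_sequential) (use assms sequential_law_input_law in auto)
  hence "(1 - err_prob \<eta> N e d n M) * log 2 (real M) - 1
      \<le> (\<Sum>m\<in>{1..M}. \<Sum>xs\<in>histories {0, 1} n. ?D m xs) / real M"
    by (simp add: err_prob_eq_decoding_error)
  also have "\<dots> \<le> (\<Sum>m\<in>{1..M}. real n) / real M"
  proof (intro divide_right_mono sum_mono)
    fix m assume "m \<in> {1..M}"
    hence "sequential_law {0, 1} n (input_law m)" by (rule sequential_law_input_law)
    thus "(\<Sum>xs\<in>histories {0, 1} n. ?D m xs) \<le> real n"
      using sequential_law.sum_step_divergence_uniform_le by fastforce
  qed simp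
  finally show ?thesis using assms by simp
qed

lemma code_rate_le_upper_bound:
  assumes n: "0 < n" and M: "0 < M"
  shows "ereal (((1 - err_prob \<eta> N e d n M) * log 2 (real M) - 1) / real (Suc (n + N)))
    \<le> upper_bound \<eta> N"
proof (cases "N = 0")
  case True
  have "((1 - err_prob \<eta> N e d n M) * log 2 (real M) - 1) / real (Suc (n + N)) \<le> 1"
    using fano_rate_le_length[OF M, of d] by (simp add: field_simps)
  hence "ereal (((1 - err_prob \<eta> N e d n M) * log 2 (real M) - 1) / real (Suc (n + N))) \<le> 1"
    by (simp add: one_ereal_def)
  also have "\<dots> \<le> upper_bound \<eta> N"
    unfolding True using eta
    by (intro alternating_policy.one_le_upper_bound alternating_policy.intro)
  finally show ?thesis .
next
  case False
  interpret block_policy \<eta> N n "{1..M}" input_law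
  proof (rule block_policy.intro)
    fix m xs assume m: "m \<in> {1..M}" and "xs \<in> histories {0, 1 :: nat} n"
    hence xs: "xs \<in> words {0, 1} (length xs)" "length xs < n"
      by (auto simp: in_histories_iff words_def)
    show "input_law m (xs @ [1]) \<le> charge \<eta> N (input_law m) xs"
      using input_law_one_le_charged[OF m xs(2)] charged_le_charge[OF m xs(1)] xs(2) by simp
  qed (use eta n M False sequential_law_input_law in auto)
  show ?thesis
    using fano_rate_le_upper_bound[of d] by (simp add: err_prob_eq_decoding_error)
qed

end

lemma penalized_rate_tendsto:
  fixes R :: real
  assumes "\<epsilon> \<longlonglongrightarrow> 0"
  shows "(\<lambda>n. ((1 - \<epsilon> n) * (real n * R) - 1) / real (Suc (n + N))) \<longlonglongrightarrow> R"
proof -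
  have inverse_tendsto: "(\<lambda>n. 1 / real (Suc (n + N))) \<longlonglongrightarrow> 0"
    using LIMSEQ_ignore_initial_segment[OF LIMSEQ_inverse_real_of_nat, of N]
    by (simp add: inverse_eq_divide)
  hence "(\<lambda>n. 1 - real (Suc N) * (1 / real (Suc (n + N)))) \<longlonglongrightarrow> 1 - real (Suc N) * 0"
    by (intro tendsto_intros)
  moreover have "1 - real (Suc N) * (1 / real (Suc (n + N))) = real n / real (Suc (n + N))" for n
    by (simp add: field_simps)
  ultimately have "(\<lambda>n. real n / real (Suc (n + N))) \<longlonglongrightarrow> 1" by simp
  hence "(\<lambda>n. (1 - \<epsilon> n) * R * (real n / real (Suc (n + N))) - 1 / real (Suc (n + N)))
      \<longlonglongrightarrow> (1 - 0) * R * 1 - 0"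
    using assms inverse_tendsto by (intro tendsto_intros)
  thus ?thesis by (simp add: diff_divide_distrib mult_ac)
qed

lemma achievable_le_upper_bound:
  assumes eta: "0 \<le> \<eta>" "\<eta> \<le> 1" and "achievable \<eta> N R"
  shows "ereal R \<le> upper_bound \<eta> N"
proof -
  obtain E D where valid: "\<And>n. valid_code N (E n) n (num_msgs R n)"
    and vanishing: "(\<lambda>n. err_prob \<eta> N (E n) (D n) n (num_msgs R n)) \<longlonglongrightarrow> 0"
    using assms(3) unfolding achievable_def by blast
  define \<epsilon> where "\<epsilon> n = err_prob \<eta> N (E n) (D n) n (num_msgs R n)" for n
  define rate where "rate n = ((1 - \<epsilon> n) * (real n * R) - 1) / real (Suc (n + N))" for n
  have rate_le: "ereal (rate n) \<le> upper_bound \<eta> N" if "0 < n" for n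
  proof -
    interpret boosted_code \<eta> N "E n" n "num_msgs R n" using eta valid by unfold_locales
    have "real n * R \<le> log 2 (real (num_msgs R n))"
      using num_msgs_ge[of n R] num_msgs_pos[of R n] by (simp add: le_log_iff)
    hence "(1 - \<epsilon> n) * (real n * R) \<le> (1 - \<epsilon> n) * log 2 (real (num_msgs R n))"
      using err_prob_le_1[of "D n"] by (intro mult_left_mono) (auto simp: \<epsilon>_def)
    hence "rate n \<le> ((1 - \<epsilon> n) * log 2 (real (num_msgs R n)) - 1) / real (Suc (n + N))"
      unfolding rate_def by (intro divide_right_mono) auto
    thus ?thesis
      using code_rate_le_upper_bound[OF that num_msgs_pos, of "D n"] unfolding \<epsilon>_def
      by (meson ereal_less_eq(3) order_trans)
  qed
  have "rate \<longlonglongrightarrow> R"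
    unfolding rate_def using vanishing unfolding \<epsilon>_def[symmetric] by (rule penalized_rate_tendsto)
  hence "(\<lambda>n. ereal (rate n)) \<longlonglongrightarrow> ereal R" by simp
  moreover have "\<exists>n0. \<forall>n\<ge>n0. ereal (rate n) \<le> upper_bound \<eta> N"
    using rate_le by (intro exI[of _ 1]) auto
  ultimately show ?thesis by (rule LIMSEQ_le_const2)
qed

theorem theorem4:
  fixes \<eta> :: real and N :: nat
  assumes "0 \<le> \<eta>" and "\<eta> \<le> 1"
  shows "boosted_capacity \<eta> N \<le> upper_bound \<eta> N"
  unfolding boosted_capacity_def
  using achievable_le_upper_bound[OF assms] by (auto intro!: Sup_least)

end
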